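(* Let $\mathcal A=(A_1,\dots,A_t)$ and $\mathcal B=(B_1,\dots,B_t)$ be two $t$-tuples of $n\times n$ matrices over $\mathbb F$. (a) Let $\mathbb F$ be an algebraically closed field of characteristic different from $2$. Then $\mathcal A$ and $\mathcal B$ are weakly symmetrically equivalent if and only if they are weakly congruent. (b) Let $\mathbb F$ be a real closed field. Then $\mathcal A$ and $\mathcal B$ are weakly symmetrically equivalent if and only if there exist $p\in\{0,1,\dots,n\}$ and a $t$-tuple $\mathcal C$ of $(p,n-p)$ block diagonal matrices over $\mathbb F$ such that $\mathcal A$ is congruent to $\mathcal C$ and $(I_p\oplus -I_{n-p})\,\mathcal C$ is weakly congruent to $\mathcal B$. (c) Let $\mathbb F$ be an algebraically closed field with a fixed nonidentity involution. Then $\mathcal A$ and $\mathcal B$ are weakly *symmetrically equivalent if and only if there exist $p\in\{0,1,\dots,n\}$ and a $t$-tuple $\mathcal C$ of $(p,n-p)$ block diagonal matrices over $\mathbb F$ such that $\mathcal A$ is *congruent to $\mathcal C$ and $(I_p\oplus -I_{n-p})\,\mathcal C$ is weakly *congruent to $\mathcal B$.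
   Context: An involution on a field $\mathbb F$ is a bijection $a\mapsto\bar a$ of $\mathbb F$ such that $\overline{a+b}=\bar a+\bar b$, $\overline{ab}=\bar b\,\bar a$ and $\bar{\bar a}=a$ for all $a,b\in\mathbb F$. For a matrix $A$ over $\mathbb F$, $A^*:=\bar A^T$. For a tuple $\mathcal A=(A_1,\dots,A_t)$ and matrices $S,R$, write $S\mathcal A R:=(SA_1R,\dots,SA_tR)$ and $S\mathcal A:=(SA_1,\dots,SA_t)$. Two $t$-tuples $\mathcal A,\mathcal B$ of $n\times n$ matrices over $\mathbb F$ are: - symmetrically equivalent if $S\mathcal A R^T=R\mathcal A S^T=\mathcal B$ for some nonsingular $n\times n$ matrices $S,R$ over $\mathbb F$; - *symmetrically equivalent if $S\mathcal A R^*=R\mathcal A S^*=\mathcal B$ for some nonsingular $S,R$; - congruent if $S\mathcal A S^T=\mathcal B$ for some nonsingular $S$; - *congruent if $S\mathcal A S^*=\mathcal B$ for some nonsingular $S$. $\mathcal A$ and $\mathcal B$ are weakly symmetrically equivalent (respectively, weakly *symmetrically equivalent, weakly congruent, weakly *congruent) if there exists a nonsingular $t\times t$ matrix $\Lambda=[\lambda_{ij}]$ over $\mathbb F$ such that $\mathcal A$ is symmetrically equivalent (respectively, *symmetrically equivalent, congruent, *congruent) to the $t$-tuple $(\lambda_{11}B_1+\dots+\lambda_{1t}B_t,\ \dots,\ \lambda_{t1}B_1+\dots+\lambda_{tt}B_t)$. For $p,q\in\{0,1,2,\dots\}$, a $(p,q)$ block diagonal matrix is a matrix of the form $\begin{bmatrix}A&0\\0&B\end{bmatrix}$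 with $A$ of size $p\times p$ and $B$ of size $q\times q$. $I_p\oplus -I_{n-p}$ denotes the block diagonal matrix with diagonal blocks $I_p$ and $-I_{n-p}$. A real closed field is a field whose algebraic closure is two-dimensional over it. *)

theory Defs
  imports
    "Jordan_Normal_Form.Matrix"
    "HOL-Algebra.Algebraic_Closure_Type"
begin

section \<open>Fields\<close>

text \<open>
  A field is real closed if its algebraic closure is two-dimensional over it.
  The constant \<open>vector_space.dim\<close> is 0 for infinite-dimensional spaces, so the value 2
  does express finite dimension.
\<close>

lemma vector_space_alg_closure:
  "vector_space (\<lambda>(c :: 'a :: field) (x :: 'a alg_closure). to_ac c * x)"
  by unfold_locales (simp_all add: algebra_simps)

definition real_closed_field :: "'a :: field itself \<Rightarrow> bool" where
  "real_closed_field _ \<longleftrightarrow>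
     vector_space.dim (\<lambda>(c :: 'a) (x :: 'a alg_closure). to_ac c * x) UNIV = 2"

definition involution :: "('a :: field \<Rightarrow> 'a) \<Rightarrow> bool" where
  "involution \<sigma> \<longleftrightarrow> bij \<sigma> \<and> (\<forall>a b. \<sigma> (a + b) = \<sigma> a + \<sigma> b) \<and>
     (\<forall>a b. \<sigma> (a * b) = \<sigma> b * \<sigma> a) \<and> (\<forall>a. \<sigma> (\<sigma> a) = a)"


section \<open>Tuples of matrices\<close>

text \<open>
  A tuple of matrices is a list; the paper's 1-based index \<open>i\<close> is the list index \<open>i - 1\<close>.
\<close>

definition mat_tuples :: "nat \<Rightarrow> nat \<Rightarrow> 'a mat list set" where
  "mat_tuples n t = {\<A>. length \<A> = t \<and> set \<A> \<subseteq> carrier_mat n n}"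

definition nonsingular_mats :: "nat \<Rightarrow> 'a :: field mat set" where
  "nonsingular_mats n = {S \<in> carrier_mat n n. invertible_mat S}"

definition star_mat :: "('a \<Rightarrow> 'a) \<Rightarrow> 'a mat \<Rightarrow> 'a mat" where
  "star_mat \<sigma> A = transpose_mat (map_mat \<sigma> A)"

definition tuple_mult :: "'a :: field mat \<Rightarrow> 'a mat list \<Rightarrow> 'a mat \<Rightarrow> 'a mat list" where
  "tuple_mult S \<A> R = map (\<lambda>A. S * A * R) \<A>"

definition tuple_left_mult :: "'a :: field mat \<Rightarrow> 'a mat list \<Rightarrow> 'a mat list" where
  "tuple_left_mult S \<A> = map (\<lambda>A. S * A) \<A>"

definition symmetrically_equivalent ::
    "nat \<Rightarrow> 'a :: field mat list \<Rightarrow> 'a mat list \<Rightarrow> bool" where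
  "symmetrically_equivalent n \<A> \<B> \<longleftrightarrow>
     (\<exists>S \<in> nonsingular_mats n. \<exists>R \<in> nonsingular_mats n.
        tuple_mult S \<A> (transpose_mat R) = \<B> \<and> tuple_mult R \<A> (transpose_mat S) = \<B>)"

definition star_symmetrically_equivalent ::
    "('a \<Rightarrow> 'a) \<Rightarrow> nat \<Rightarrow> 'a :: field mat list \<Rightarrow> 'a mat list \<Rightarrow> bool" where
  "star_symmetrically_equivalent \<sigma> n \<A> \<B> \<longleftrightarrow>
     (\<exists>S \<in> nonsingular_mats n. \<exists>R \<in> nonsingular_mats n.
        tuple_mult S \<A> (star_mat \<sigma> R) = \<B> \<and> tuple_mult R \<A> (star_mat \<sigma> S) = \<B>)"

definition tuple_congruent :: "nat \<Rightarrow> 'a :: field mat list \<Rightarrow> 'a mat list \<Rightarrow> bool" where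
  "tuple_congruent n \<A> \<B> \<longleftrightarrow>
     (\<exists>S \<in> nonsingular_mats n. tuple_mult S \<A> (transpose_mat S) = \<B>)"

definition star_congruent ::
    "('a \<Rightarrow> 'a) \<Rightarrow> nat \<Rightarrow> 'a :: field mat list \<Rightarrow> 'a mat list \<Rightarrow> bool" where
  "star_congruent \<sigma> n \<A> \<B> \<longleftrightarrow>
     (\<exists>S \<in> nonsingular_mats n. tuple_mult S \<A> (star_mat \<sigma> S) = \<B>)"

text \<open>
  The \<open>i\<close>-th entry of \<open>lin_comb_tuple n \<Lambda> \<B>\<close> is the \<open>n \<times> n\<close> matrix
  \<open>\<lambda>\<^sub>i\<^sub>1 B\<^sub>1 + \<dots> + \<lambda>\<^sub>i\<^sub>t B\<^sub>t\<close>, written entrywise because matrices of arbitrary size have no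
  common zero for a big sum.
\<close>

definition lin_comb_tuple :: "nat \<Rightarrow> 'a :: field mat \<Rightarrow> 'a mat list \<Rightarrow> 'a mat list" where
  "lin_comb_tuple n \<Lambda> \<B> =
     map (\<lambda>i. mat n n (\<lambda>(r, c). \<Sum>j < length \<B>. \<Lambda> $$ (i, j) * (\<B> ! j) $$ (r, c)))
       [0..<length \<B>]"

definition weakly ::
    "(nat \<Rightarrow> 'a :: field mat list \<Rightarrow> 'a mat list \<Rightarrow> bool) \<Rightarrow>
     nat \<Rightarrow> 'a mat list \<Rightarrow> 'a mat list \<Rightarrow> bool" where
  "weakly rel n \<A> \<B> \<longleftrightarrow>
     (\<exists>\<Lambda> \<in> nonsingular_mats (length \<B>). rel n \<A> (lin_comb_tuple n \<Lambda> \<B>))"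


section \<open>Block diagonal matrices\<close>

definition block_diag :: "'a :: field mat \<Rightarrow> 'a mat \<Rightarrow> 'a mat" where
  "block_diag A B =
     four_block_mat A (0\<^sub>m (dim_row A) (dim_col B)) (0\<^sub>m (dim_row B) (dim_col A)) B"

definition block_diag_mats :: "nat \<Rightarrow> nat \<Rightarrow> 'a :: field mat set" where
  "block_diag_mats p q = {block_diag A B | A B. A \<in> carrier_mat p p \<and> B \<in> carrier_mat q q}"

definition signature_mat :: "nat \<Rightarrow> nat \<Rightarrow> 'a :: field mat" where
  "signature_mat p q = block_diag (1\<^sub>m p) (- 1\<^sub>m q)"

end

theory Submission
  imports Defs "Jordan_Normal_Form.Char_Poly"
begin

text \<open>
  Transposition is the star operation for the identity involution, so all three parts can be
  treated alike. Suppose \<open>S A R\<^sup>* = R A S\<^sup>* = B\<close> for corresponding members of the two tuples. With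
  \<open>M = R\<inverse> S\<close> this says \<open>M A = A M\<^sup>*\<close> and \<open>B = R (M A) R\<^sup>*\<close>. The first relation is inherited by
  every polynomial \<open>N\<close> in \<open>M\<close> with coefficients fixed by the involution (real coefficients), so a
  factorisation \<open>M = N\<^sup>2\<close> gives \<open>B = (R N) A (R N)\<^sup>*\<close>, a congruence that does not depend on the
  member of the tuple. This settles part (a), where polynomial square roots exist.

  In parts (b) and (c) negative eigenvalues have no real square root, and the factorisation is
  \<open>M = N E N\<close> with an additional real polynomial \<open>E\<close> in \<open>M\<close> such that \<open>E\<^sup>2 = 1\<close>
  (\<open>signed_real_matrix_sqrt\<close>, \<open>real_closed_signed_matrix_sqrt\<close>). Diagonalising \<open>E\<close> to
  \<open>D = I\<^sub>p \<oplus> -I\<^sub>n\<^sub>-\<^sub>p\<close> transforms every \<open>A\<close> by one congruence into a matrix \<open>C\<close> that commutes with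
  \<open>D\<close> because \<open>E A = A E\<^sup>*\<close>. Hence \<open>C\<close> is block diagonal, and \<open>D C\<close> is congruent to \<open>B\<close>
  (\<open>signed_sqrt_imp_signature_congruent\<close>). Conversely \<open>C\<close> and \<open>D C = C D\<close> are symmetrically
  equivalent for block diagonal \<open>C\<close>. The change of basis \<open>\<Lambda>\<close> in the weak notions affects only the
  right-hand tuple and is carried along.

  The factorisation is a congruence of polynomials modulo a power of \<open>\<omega> = \<Prod>z\<in>Z. (x - z)\<close>, where
  \<open>Z\<close> is a conjugation-invariant set of nonzero points containing the spectrum of \<open>M\<close>: a square
  root is prescribed on \<open>Z\<close> by interpolation and lifted by Newton's method
  (\<open>real_square_root_exists\<close>). Averaging a polynomial with its conjugate keeps everything real,
  provided that the values on \<open>Z\<close> are chosen equivariantly. That this is possible up to signs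
  \<open>\<epsilon> = \<plusminus> 1\<close> (\<open>equivariant_signed_sqrt\<close>) is a fragment of Artin-Schreier theory for an
  algebraically closed field with a nonidentity involution. A real closed field is the fixed field
  of such an involution on its algebraic closure (\<open>real_closed_conjugation\<close>), so (b) uses the same
  polynomials as (c) and descends them to the field.
\<close>

section \<open>Polynomials fixed by an involution\<close>

locale field_involution =
  fixes \<sigma> :: "'a :: field \<Rightarrow> 'a"
  assumes involution: "involution \<sigma>"
begin

lemma conj_conj [simp]: "\<sigma> (\<sigma> x) = x"
  using involution by (simp add: involution_def)

sublocale field_hom \<sigma>
proof
  have add: "\<sigma> (x + y) = \<sigma> x + \<sigma> y" and mult: "\<sigma> (x * y) = \<sigma> x * \<sigma> y" for x y
    using involution by (auto simp: involution_def mult.commute)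
  show "\<sigma> 0 = 0" using add[of 0 0] by (metis add_cancel_left_left)
  have "\<sigma> 1 * \<sigma> (\<sigma> 1) = \<sigma> (\<sigma> 1)" using mult[of 1 "\<sigma> 1"] by simp
  then show "\<sigma> 1 = 1" by simp
  show "\<sigma> (x + y) = \<sigma> x + \<sigma> y" "\<sigma> (x * y) = \<sigma> x * \<sigma> y" for x y
    by (fact add mult)+
qed

sublocale on_poly: map_poly_comm_ring_hom \<sigma> ..

text \<open>
  The model is complex conjugation: elements fixed by \<open>\<sigma>\<close> are called real, and a polynomial is
  real if its coefficients are. For \<open>\<sigma> = id\<close> every polynomial is real.
\<close>
definition real_polys :: "'a poly set" where
  "real_polys = {f. map_poly \<sigma> f = f}"

lemma real_polys_closed:
  assumes "f \<in> real_polys" "g \<in> real_polys"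
  shows "f + g \<in> real_polys" "f - g \<in> real_polys" "f * g \<in> real_polys"
  using assms by (auto simp: real_polys_def hom_distribs)

lemma one_real_poly: "1 \<in> real_polys"
  by (simp add: real_polys_def)

lemma X_real_poly: "[:0, 1:] \<in> real_polys"
  by (simp add: real_polys_def map_poly_pCons)

lemma real_poly_average:
  assumes "(2 :: 'a) \<noteq> 0"
  shows "smult (1 / 2) (f + map_poly \<sigma> f) \<in> real_polys"
proof -
  have "\<sigma> (1 / 2) = 1 / 2"
    by (simp add: hom_distribs)
  moreover have "map_poly \<sigma> (map_poly \<sigma> f) = f"
    by (rule poly_eqI) (simp add: coeff_map_poly)
  ultimately show ?thesis
    by (simp add: real_polys_def hom_distribs add.commute)
qed

end

section \<open>Square roots modulo a product of linear factors\<close>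

lemma interpolation_exists:
  assumes "finite Z"
  shows "\<exists>f :: 'a :: field poly. \<forall>z\<in>Z. poly f z = v z"
  using assms
proof (induction Z)
  case (insert a Z)
  then obtain f where f: "\<forall>z\<in>Z. poly f z = v z" by blast
  define w where "w = (\<Prod>z\<in>Z. [:- z, 1:])"
  have "poly w a \<noteq> 0" "\<forall>z\<in>Z. poly w z = 0"
    using insert by (auto simp: w_def poly_prod)
  then have "\<forall>z\<in>insert a Z. poly (f + smult ((v a - poly f a) / poly w a) w) z = v z"
    using f by auto
  then show ?case by blast
qed auto

lemma prod_linear_dvd:
  assumes "finite Z" "\<forall>z\<in>Z. poly p z = 0"
  shows "(\<Prod>z\<in>Z. [:- z, 1 :: 'a :: field:]) dvd p"
  using assms
proof (induction Z arbitrary: p)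
  case (insert a Z)
  then obtain q where q: "p = [:- a, 1:] * q"
    by (metis insertI1 poly_eq_0_iff_dvd dvdE)
  have "\<forall>z\<in>Z. poly q z = 0"
  proof
    fix z assume "z \<in> Z"
    then have "poly p z = 0" "z \<noteq> a" using insert by auto
    then show "poly q z = 0" by (simp add: q)
  qed
  then have "(\<Prod>z\<in>Z. [:- z, 1:]) dvd q" using insert by blast
  then show ?case using insert by (simp add: q mult_dvd_mono del: mult_pCons_left)
qed auto

context field_involution
begin

text \<open>
  If \<open>f\<close> interpolates \<open>\<sigma>\<close>-equivariant values on a \<open>\<sigma>\<close>-invariant set, so does the conjugate of \<open>f\<close>,
  and hence the average of the two, which is real.
\<close>
lemma real_interpolation_exists:
  assumes two: "(2 :: 'a) \<noteq> 0"
    and "finite Z" "\<And>z. z \<in> Z \<Longrightarrow> \<sigma> z \<in> Z" "\<And>z. z \<in> Z \<Longrightarrow> v (\<sigma> z) = \<sigma> (v z)"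
  obtains f where "f \<in> real_polys" "\<And>z. z \<in> Z \<Longrightarrow> poly f z = v z"
proof -
  obtain f where f: "\<forall>z\<in>Z. poly f z = v z" using interpolation_exists[OF \<open>finite Z\<close>] by blast
  show ?thesis
  proof
    show "smult (1 / 2) (f + map_poly \<sigma> f) \<in> real_polys" by (rule real_poly_average[OF two])
    fix z assume z: "z \<in> Z"
    have "poly (map_poly \<sigma> f) z = \<sigma> (poly f (\<sigma> z))"
      by (metis poly_map_poly conj_conj)
    also have "\<dots> = v z" using assms f z by simp
    finally show "poly (smult (1 / 2) (f + map_poly \<sigma> f)) z = v z"
      using f z two by (simp add: field_simps)
  qed
qed

text \<open>
  Newton's iteration for \<open>f\<^sup>2 = h\<close>. The derivative \<open>2 f\<close> has the prescribed values \<open>2 s z\<close> at the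
  nodes throughout, so one polynomial \<open>g\<close> that interpolates \<open>1 / (2 s z)\<close> can serve as its
  approximate inverse in every step. Each step gains one factor \<open>\<omega> = \<Prod>z\<in>Z. (x - z)\<close>. All
  polynomials involved are real, which is why only interpolation needs \<open>\<sigma>\<close>.
\<close>
lemma real_square_root_exists:
  assumes two: "(2 :: 'a) \<noteq> 0"
    and Z: "finite Z" "\<And>z. z \<in> Z \<Longrightarrow> \<sigma> z \<in> Z"
    and s: "\<And>z. z \<in> Z \<Longrightarrow> s (\<sigma> z) = \<sigma> (s z)" "\<And>z. z \<in> Z \<Longrightarrow> s z \<noteq> 0"
    and h: "h \<in> real_polys" "\<And>z. z \<in> Z \<Longrightarrow> poly h z = s z ^ 2"
  obtains f where "f \<in> real_polys" "\<And>z. z \<in> Z \<Longrightarrow> poly f z = s z"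
    "(\<Prod>z\<in>Z. [:- z, 1:]) ^ k dvd f ^ 2 - h"
proof -
  define \<omega> where "\<omega> = (\<Prod>z\<in>Z. [:- z, 1:])"
  \<comment> \<open>\<open>g\<close> is an inverse of the derivative \<open>2 f\<close> modulo \<open>\<omega>\<close> for every \<open>f\<close> with values \<open>s\<close>.\<close>
  obtain g where g: "g \<in> real_polys" "\<And>z. z \<in> Z \<Longrightarrow> poly g z = 1 / (2 * s z)"
    by (rule real_interpolation_exists[OF two Z, of "\<lambda>z. 1 / (2 * s z)"])
      (auto simp: s hom_distribs)
  have "\<exists>f \<in> real_polys. (\<forall>z\<in>Z. poly f z = s z) \<and> \<omega> ^ k dvd f ^ 2 - h"
  proof (induction k)
    case 0
    show ?case
      by (rule real_interpolation_exists[OF two Z, of s]) (auto simp: s)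
  next
    case (Suc k)
    then obtain f where f: "f \<in> real_polys" "\<forall>z\<in>Z. poly f z = s z" "\<omega> ^ k dvd f ^ 2 - h"
      by blast
    define d where "d = h - f ^ 2"
    have d: "\<omega> ^ k dvd d" using f(3) by (simp add: d_def dvd_diff_commute)
    have d0: "poly d z = 0" if "z \<in> Z" for z using that f h by (simp add: d_def)
    have "\<omega> dvd d" unfolding \<omega>_def using Z d0 by (intro prod_linear_dvd) auto
    moreover have "\<omega> dvd 1 - 2 * f * g" unfolding \<omega>_def
      using Z f g s two by (intro prod_linear_dvd) auto
    ultimately have "\<omega> dvd d * g ^ 2 - (1 - 2 * f * g)" by (auto intro: dvd_diff)
    then have "\<omega> ^ k * \<omega> dvd d * (d * g ^ 2 - (1 - 2 * f * g))"
      using d by (rule mult_dvd_mono[rotated])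
    also have "\<dots> = (f + d * g) ^ 2 - h"
      by (simp add: d_def algebra_simps power2_eq_square)
    finally have "\<omega> ^ Suc k dvd (f + d * g) ^ 2 - h" by (simp add: mult.commute)
    moreover have "f + d * g \<in> real_polys"
      using f(1) g(1) h(1) by (simp add: d_def power2_eq_square real_polys_closed)
    moreover have "\<forall>z\<in>Z. poly (f + d * g) z = s z" using f d0 by simp
    ultimately show ?case by blast
  qed
  then show ?thesis using that by (auto simp: \<omega>_def)
qed

end

text \<open>
  Every linear factor of \<open>p\<close> divides the product over \<open>Z\<close>, and \<open>p\<close> has \<open>degree p\<close> of them.
\<close>
lemma poly_dvd_power_of_linear_prod:
  fixes p :: "'a :: alg_closed_field poly"
  assumes "p \<noteq> 0" "finite Z" "{z. poly p z = 0} \<subseteq> Z"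
  shows "p dvd (\<Prod>z\<in>Z. [:- z, 1:]) ^ degree p"
proof -
  define \<omega> where "\<omega> = (\<Prod>z\<in>Z. [:- z, 1:])"
  obtain A where A: "size A = degree p" "p = smult (lead_coeff p) (\<Prod>x\<in>#A. [:-x, 1:])"
    using alg_closed_imp_factorization[OF \<open>p \<noteq> 0\<close>] by blast
  have roots: "set_mset A \<subseteq> Z"
  proof
    fix x assume "x \<in># A"
    then have "poly p x = 0"
      by (subst A(2)) (auto simp: poly_prod_mset prod_mset_zero_iff)
    then show "x \<in> Z" using assms by auto
  qed
  then have "(\<Prod>x\<in>#A. [:-x, 1:]) dvd \<omega> ^ size A"
  proof (induction A)
    case (add x A)
    then have "[:-x, 1:] dvd \<omega>" unfolding \<omega>_def
      using assms by (intro dvd_prodI) auto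
    then show ?case using add by (auto intro!: mult_dvd_mono simp del: mult_pCons_left)
  qed simp
  then have "smult (lead_coeff p) (\<Prod>x\<in>#A. [:-x, 1:]) dvd \<omega> ^ size A"
    using \<open>p \<noteq> 0\<close> by (simp add: smult_dvd)
  then show ?thesis using A unfolding \<omega>_def by simp
qed

section \<open>Nonidentity involutions on algebraically closed fields\<close>

text \<open>
  A nonidentity involution on an algebraically closed field behaves like complex conjugation. The
  lemmas below are the part of the Artin-Schreier theorem that is needed to choose square roots
  equivariantly.
\<close>
locale alg_closed_involution = field_involution \<sigma> for \<sigma> :: "'a :: alg_closed_field \<Rightarrow> 'a" +
  assumes nonidentity: "\<sigma> \<noteq> id"
begin

lemma sqrt_exists: "\<exists>y. y ^ 2 = (x :: 'a)"
  using nth_root_exists[of 2 x] by simp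

text \<open>
  In characteristic two the field would be generated over the fixed field by a root \<open>\<theta>\<close> of
  \<open>x\<^sup>2 + x = c\<close> with \<open>c\<close> real and \<open>\<sigma> \<theta> = \<theta> + 1\<close>. Solving \<open>y\<^sup>2 + y = c \<theta>\<close> and taking the trace
  \<open>v = y + \<sigma> y\<close> yields a real root \<open>v\<close> of the same equation, so that \<open>\<theta>\<close> would be real as well.
\<close>
lemma two_neq_0: "(2 :: 'a) \<noteq> 0"
proof
  assume two: "(2 :: 'a) = 0"
  then have double: "x + x = 0" for x :: 'a
    by (metis mult_2 mult_zero_left)
  then have neg: "- x = x" for x :: 'a by (metis minus_unique)
  have sq: "(x + y) ^ 2 = x ^ 2 + y ^ 2" for x y :: 'a
    by (simp add: power2_sum two)
  obtain z where z: "\<sigma> z \<noteq> z" using nonidentity by (auto simp: fun_eq_iff)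
  define t where "t = z + \<sigma> z"
  have "t \<noteq> 0" using z neg by (metis t_def add_eq_0_iff)
  have t: "\<sigma> t = t" by (simp add: t_def hom_distribs add.commute)
  define \<theta> where "\<theta> = z / t"
  have \<theta>: "\<sigma> \<theta> = \<theta> + 1"
  proof -
    have "\<sigma> \<theta> = \<sigma> z / t" by (simp add: \<theta>_def hom_distribs t)
    also have "\<sigma> z = z + t" using double[of z] by (simp add: t_def flip: add.assoc)
    finally show ?thesis using \<open>t \<noteq> 0\<close> by (simp add: \<theta>_def add_divide_distrib)
  qed
  define c where "c = \<theta> ^ 2 + \<theta>"
  have c: "\<sigma> c = c"
    using two double[of 1] by (simp add: c_def hom_distribs \<theta> sq algebra_simps) 
  have "[:- (c * \<theta>), 1, 1:] \<noteq> 0" "degree [:- (c * \<theta>), 1, 1:] = 2" by auto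
  then obtain y where "poly [:- (c * \<theta>), 1, 1:] y = 0"
    using alg_closed_imp_poly_has_root[of "[:- (c * \<theta>), 1, 1:]"] by auto
  then have y: "y ^ 2 + y = c * \<theta>" by (simp add: algebra_simps power2_eq_square)
  define v where "v = y + \<sigma> y"
  have "v ^ 2 + v = (y ^ 2 + y) + \<sigma> (y ^ 2 + y)"
    by (simp add: v_def hom_distribs sq algebra_simps)
  also have "\<dots> = c * (\<theta> + \<theta>) + c"
    unfolding y by (simp add: hom_mult c \<theta> algebra_simps)
  also have "\<dots> = c" using double by simp
  finally have "v ^ 2 + v = \<theta> ^ 2 + \<theta>" by (simp add: c_def)
  then have "(v - \<theta>) * (v + \<theta> + 1) = 0" by (simp add: algebra_simps power2_eq_square)
  then have "\<theta> = v \<or> \<theta> = v + 1"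
    by (metis add.assoc add.commute add_eq_0_iff eq_iff_diff_eq_0 mult_eq_0_iff neg)
  moreover have "\<sigma> v = v" by (simp add: v_def hom_distribs add.commute)
  ultimately have "\<sigma> \<theta> = \<theta>" by (auto simp: hom_distribs)
  then show False using \<theta> by simp
qed

text \<open>
  If \<open>w = z\<^sup>2\<close>, the norm of \<open>w\<close> is the square of the norm of \<open>z\<close>, which is real.
\<close>
lemma norm_is_real_square: "\<exists>r. \<sigma> r = r \<and> w * \<sigma> w = r ^ 2"
proof -
  obtain z where z: "z ^ 2 = w" using sqrt_exists by blast
  have "\<sigma> (z * \<sigma> z) = z * \<sigma> z" by (simp add: hom_distribs mult.commute)
  moreover have "w * \<sigma> w = (z * \<sigma> z) ^ 2"
    by (simp add: hom_distribs power_mult_distrib flip: z)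
  ultimately show ?thesis by blast
qed

text \<open>
  Take \<open>\<theta> \<noteq> 0\<close> with \<open>\<sigma> \<theta> = - \<theta>\<close>. Its norm \<open>- \<theta>\<^sup>2\<close> is a real square \<open>q\<^sup>2\<close>, so \<open>r\<^sup>2 = -1\<close> with
  real \<open>r\<close> would make \<open>\<theta> = \<plusminus> r q\<close> real.
\<close>
lemma minus_one_not_real_square: "\<sigma> r = r \<Longrightarrow> r ^ 2 \<noteq> -1"
proof
  assume r: "\<sigma> r = r" "r ^ 2 = -1"
  obtain z where z: "\<sigma> z \<noteq> z" using nonidentity by (auto simp: fun_eq_iff)
  define \<theta> where "\<theta> = z - \<sigma> z"
  have \<theta>: "\<sigma> \<theta> = - \<theta>" "\<theta> \<noteq> 0" using z by (auto simp: \<theta>_def hom_distribs)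
  obtain q where q: "\<sigma> q = q" "\<theta> * \<sigma> \<theta> = q ^ 2" using norm_is_real_square by blast
  have "q ^ 2 = - (\<theta> ^ 2)" unfolding q(2)[symmetric] by (simp add: \<theta>(1) power2_eq_square)
  then have "\<theta> ^ 2 = (r * q) ^ 2" by (simp add: power_mult_distrib r(2))
  then have "\<theta> = r * q \<or> \<theta> = - (r * q)" by (simp add: power2_eq_iff)
  moreover have "\<sigma> (r * q) = r * q" by (simp add: hom_mult r(1) q(1))
  ultimately have "\<sigma> \<theta> = \<theta>" by (metis hom_uminus)
  then have "2 * \<theta> = 0" unfolding \<theta>(1) mult_2 by (metis add.left_inverse)
  then show False using two_neq_0 \<theta> by simp
qed

text \<open>
  The squares of the fixed field are its nonnegative elements: they single out one sign of every
  nonzero real element.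
\<close>
definition nonneg_real :: "'a \<Rightarrow> bool" where
  "nonneg_real a \<longleftrightarrow> (\<exists>r. \<sigma> r = r \<and> a = r ^ 2)"

lemma nonneg_real_cases:
  assumes "\<sigma> a = a" shows "nonneg_real a \<or> nonneg_real (- a)"
proof -
  obtain b where b: "b ^ 2 = a" using sqrt_exists by blast
  then have "\<sigma> b ^ 2 = b ^ 2" using assms by (metis hom_power)
  then consider "\<sigma> b = b" | "\<sigma> b = - b" by (auto simp: power2_eq_iff)
  then show ?thesis
  proof cases
    case 1
    then show ?thesis using b by (auto simp: nonneg_real_def)
  next
    case 2
    then have "- a = b * \<sigma> b" using b by (simp add: power2_eq_square)
    then show ?thesis using norm_is_real_square[of b] by (auto simp: nonneg_real_def)
  qed
qed

lemma nonneg_real_antisym: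
  assumes "nonneg_real a" "nonneg_real (- a)" shows "a = 0"
proof (rule ccontr)
  assume "a \<noteq> 0"
  obtain r q where r: "\<sigma> r = r" "a = r ^ 2" "\<sigma> q = q" "- a = q ^ 2"
    using assms by (auto simp: nonneg_real_def)
  then have "\<sigma> (q / r) = q / r" by (simp add: hom_distribs)
  moreover have "(q / r) ^ 2 = -1" using r \<open>a \<noteq> 0\<close> by (simp add: power_divide flip: r(2,4))
  ultimately show False using minus_one_not_real_square by blast
qed

text \<open>
  A square root is determined up to sign, and the sign has to be chosen compatibly with \<open>\<sigma>\<close>. If a
  root \<open>w\<close> of \<open>x\<close> has nonzero trace \<open>w + \<sigma> w\<close>, exactly one of \<open>\<plusminus> w\<close> has a nonnegative trace, and
  this normalisation is invariant under \<open>\<sigma>\<close>. If the trace is zero, then \<open>x = - (w * \<sigma> w)\<close> is the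
  negative of a norm; in this case \<open>- x\<close> has a real square root and the sign \<open>\<epsilon> x = - 1\<close> is used.
\<close>
lemma equivariant_signed_sqrt:
  obtains s \<epsilon> where "\<And>x. x \<noteq> 0 \<Longrightarrow> s x ^ 2 = \<epsilon> x * x" "\<And>x. x \<noteq> 0 \<Longrightarrow> \<epsilon> x = 1 \<or> \<epsilon> x = - 1"
    "\<And>x. x \<noteq> 0 \<Longrightarrow> s (\<sigma> x) = \<sigma> (s x)" "\<And>x. x \<noteq> 0 \<Longrightarrow> \<epsilon> (\<sigma> x) = \<epsilon> x"
proof -
  define P where "P x w \<longleftrightarrow> w ^ 2 = x \<and> w + \<sigma> w \<noteq> 0 \<and> nonneg_real (w + \<sigma> w)" for x w
  have P_unique: "w = w'" if "P x w" "P x w'" for x w w'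
  proof (rule ccontr)
    assume "w \<noteq> w'"
    then have "w' = - w" using that by (auto simp: P_def power2_eq_iff)
    then have "w' + \<sigma> w' = - (w + \<sigma> w)" by (simp add: hom_distribs)
    then show False using that nonneg_real_antisym by (metis P_def)
  qed
  have P_conj: "P (\<sigma> x) (\<sigma> w)" if "P x w" for x w
    using that by (auto simp: P_def add.commute hom_distribs)
  \<comment> \<open>\<open>P\<close> describes the normalised roots of \<open>x\<close>, \<open>N\<close> the real roots of \<open>- x\<close>.\<close>
  define N where "N x r \<longleftrightarrow> \<sigma> r = r \<and> r ^ 2 = - x" for x r
  have ex: "\<exists>w. P x w \<or> N x w" for x
  proof -
    obtain w where w: "w ^ 2 = x" using sqrt_exists by blast
    show ?thesis
    proof (cases "w + \<sigma> w = 0")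
      case True
      then have "\<sigma> w = - w" by (simp add: add_eq_0_iff)
      then have "w * \<sigma> w = - x" using w by (simp add: power2_eq_square)
      then show ?thesis using norm_is_real_square[of w] by (auto simp: N_def)
    next
      case False
      have "\<sigma> (w + \<sigma> w) = w + \<sigma> w" by (simp add: hom_distribs add.commute)
      then consider "nonneg_real (w + \<sigma> w)" | "nonneg_real (- w + \<sigma> (- w))"
        using nonneg_real_cases[of "w + \<sigma> w"] by (auto simp: hom_distribs)
      then show ?thesis
      proof cases
        case 1
        then show ?thesis using w False by (auto simp: P_def)
      next
        case 2
        moreover have "- w + \<sigma> (- w) \<noteq> 0" using False by (simp add: hom_distribs add_eq_0_iff)
        ultimately show ?thesis using w unfolding P_def by (metis power2_minus)
      qed
    qed
  qed
  define pos where "pos x \<longleftrightarrow> (\<exists>w. P x w)" for x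
  have pos_conj: "pos (\<sigma> x) \<longleftrightarrow> pos x" for x
    using P_conj by (metis conj_conj pos_def)
  define s where "s x = (if pos x then THE w. P x w else SOME w. N x w)" for x
  have s_pos: "P x (s x)" if "pos x" for x
    using that P_unique by (auto simp: s_def pos_def intro: theI2)
  have s_neg: "N x (s x)" if "\<not> pos x" for x
    using that ex[of x] by (auto simp: s_def pos_def intro: someI_ex)
  show ?thesis
  proof
    fix x :: 'a
    assume "x \<noteq> 0"
    show "s x ^ 2 = (if pos x then 1 else - 1) * x"
      using s_pos[of x] s_neg[of x] by (auto simp: P_def N_def)
    show "(if pos x then 1 else - 1) = (1 :: 'a) \<or> (if pos x then 1 else - 1) = - (1 :: 'a)"
      by simp
    show "s (\<sigma> x) = \<sigma> (s x)"
    proof (cases "pos x")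
      case True
      then show ?thesis using P_unique s_pos P_conj pos_conj by blast
    next
      case False
      then have "\<sigma> x = x" using s_neg[of x]
        by (metis N_def add.inverse_inverse hom_power hom_uminus)
      then show ?thesis using s_neg[OF False] by (simp add: N_def)
    qed
    show "(if pos (\<sigma> x) then 1 else - 1) = (if pos x then 1 else - (1 :: 'a))"
      by (simp add: pos_conj)
  qed
qed

end

section \<open>Polynomials in a square matrix\<close>

definition poly_mat :: "'a :: comm_ring_1 poly \<Rightarrow> 'a mat \<Rightarrow> 'a mat" where
  "poly_mat p M = fold_coeffs (\<lambda>a Y. a \<cdot>\<^sub>m 1\<^sub>m (dim_row M) + M * Y) p (0\<^sub>m (dim_row M) (dim_row M))"

context
  fixes M :: "'a :: comm_ring_1 mat" and n :: nat
  assumes M [simp]: "M \<in> carrier_mat n n"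
begin

lemma poly_mat_0: "poly_mat 0 M = 0\<^sub>m n n"
  by (simp add: poly_mat_def carrier_matD[OF M])

lemma poly_mat_pCons: "poly_mat (pCons a p) M = a \<cdot>\<^sub>m 1\<^sub>m n + M * poly_mat p M"
proof -
  have "0 \<cdot>\<^sub>m 1\<^sub>m n = (0\<^sub>m n n :: 'a mat)" by (auto intro!: eq_matI)
  then show ?thesis
    using right_mult_zero_mat[OF M] unfolding poly_mat_def carrier_matD(1)[OF M]
    by (cases "a = 0 \<and> p = 0") auto
qed

lemma poly_mat_carrier: "poly_mat p M \<in> carrier_mat n n"
  by (induction p) (auto simp: poly_mat_0 poly_mat_pCons intro!: add_carrier_mat mult_carrier_mat[OF M])

lemma poly_mat_dim: "dim_row (poly_mat p M) = n" "dim_col (poly_mat p M) = n"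
  using poly_mat_carrier by blast+

lemma poly_mat_1: "poly_mat 1 M = 1\<^sub>m n"
  unfolding one_pCons poly_mat_pCons poly_mat_0 right_mult_zero_mat[OF M] by auto

lemma poly_mat_X: "poly_mat [:0, 1:] M = M"
  unfolding one_pCons[symmetric] poly_mat_pCons poly_mat_1 poly_mat_0 right_mult_one_mat[OF M]
    right_mult_zero_mat[OF M]
  by (intro eq_matI) (simp_all add: carrier_matD[OF M])

lemma poly_mat_add: "poly_mat (p + q) M = poly_mat p M + poly_mat q M"
proof (induction p q rule: poly_induct2)
  case (pCons a p b q)
  have "M * (poly_mat p M + poly_mat q M) = M * poly_mat p M + M * poly_mat q M"
    by (rule mult_add_distrib_mat[OF M poly_mat_carrier poly_mat_carrier])
  then show ?case using pCons
    by (intro eq_matI) (auto simp: poly_mat_pCons poly_mat_dim carrier_matD[OF M] algebra_simps)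
qed (simp add: poly_mat_0)

lemma poly_mat_smult: "poly_mat (smult c p) M = c \<cdot>\<^sub>m poly_mat p M"
proof (induction p)
  case (pCons a p)
  have "M * (c \<cdot>\<^sub>m poly_mat p M) = c \<cdot>\<^sub>m (M * poly_mat p M)"
    by (rule mult_smult_distrib[OF M poly_mat_carrier])
  then show ?case using pCons
    by (intro eq_matI) (auto simp: poly_mat_pCons poly_mat_dim carrier_matD[OF M] algebra_simps)
qed (auto simp: poly_mat_0 intro!: eq_matI)

lemma poly_mat_mult: "poly_mat (p * q) M = poly_mat p M * poly_mat q M"
proof (induction p)
  case (pCons a p)
  let ?Y = "poly_mat p M" and ?Z = "poly_mat q M"
  note [simp] = poly_mat_carrier
  have "pCons a p * q = smult a q + pCons 0 (p * q)" by simp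
  then have "poly_mat (pCons a p * q) M = a \<cdot>\<^sub>m ?Z + poly_mat (pCons 0 (p * q)) M"
    by (simp only: poly_mat_add poly_mat_smult)
  also have "poly_mat (pCons 0 (p * q)) M = M * (?Y * ?Z)"
    unfolding poly_mat_pCons pCons
    by (intro eq_matI) (auto simp: poly_mat_dim carrier_matD[OF M])
  also have "a \<cdot>\<^sub>m ?Z + M * (?Y * ?Z) = (a \<cdot>\<^sub>m 1\<^sub>m n) * ?Z + (M * ?Y) * ?Z"
    by (simp add: assoc_mult_mat[OF M poly_mat_carrier poly_mat_carrier]
        mult_smult_assoc_mat[of _ n n _ n] left_mult_one_mat[OF poly_mat_carrier])
  also have "\<dots> = poly_mat (pCons a p) M * ?Z"
    unfolding poly_mat_pCons
    by (rule add_mult_distrib_mat[OF _ mult_carrier_mat[OF M poly_mat_carrier] poly_mat_carrier, symmetric])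
      simp
  finally show ?case .
qed (simp add: poly_mat_0 left_mult_zero_mat[OF poly_mat_carrier])

text \<open>
  The value of a polynomial at \<open>M\<close> depends only on its residue modulo a polynomial annihilating \<open>M\<close>.
  This turns congruences of polynomials into identities of matrices.
\<close>
lemma poly_mat_cong_dvd:
  assumes "p dvd q - q'" "poly_mat p M = 0\<^sub>m n n"
  shows "poly_mat q M = poly_mat q' M"
proof -
  obtain r where "q - q' = p * r" using assms(1) by (elim dvdE)
  then have "q = p * r + q'" by (simp add: algebra_simps)
  then show ?thesis
    by (simp add: poly_mat_add poly_mat_mult assms left_mult_zero_mat[OF poly_mat_carrier]
        left_add_zero_mat[OF poly_mat_carrier])
qed

lemma poly_mat_sum_index:
  assumes "i < n" "j < n"
  shows "poly_mat (\<Sum>k\<in>K. f k) M $$ (i, j) = (\<Sum>k\<in>K. poly_mat (f k) M $$ (i, j))"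
proof (induction K rule: infinite_finite_induct)
  case (insert k K)
  then show ?case
    using assms poly_mat_carrier[of "f k"] poly_mat_carrier[of "sum f K"] by (simp add: poly_mat_add)
qed (use assms in \<open>simp_all add: poly_mat_0\<close>)

end

lemma poly_mat_intertwine:
  assumes M: "M \<in> carrier_mat n n" and A: "A \<in> carrier_mat n m" and M': "M' \<in> carrier_mat m m"
    and MA: "M * A = A * M'"
  shows "poly_mat p M * A = A * poly_mat p M'"
proof (induction p)
  case 0
  show ?case using A by (simp add: poly_mat_0[OF M] poly_mat_0[OF M'])
next
  case (pCons a p)
  let ?Y = "poly_mat p M" and ?Y' = "poly_mat p M'"
  note carrier = poly_mat_carrier[OF M] poly_mat_carrier[OF M']
  have "poly_mat (pCons a p) M * A = a \<cdot>\<^sub>m 1\<^sub>m n * A + M * ?Y * A"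
    unfolding poly_mat_pCons[OF M]
    by (rule add_mult_distrib_mat[OF _ mult_carrier_mat[OF M carrier(1)] A]) simp
  also have "M * ?Y * A = M * (A * ?Y')"
    using A by (simp add: assoc_mult_mat[OF M _ A] pCons carrier)
  also have "\<dots> = A * M' * ?Y'" by (simp add: assoc_mult_mat[OF M A carrier(2), symmetric] MA)
  also have "\<dots> = A * (M' * ?Y')" by (rule assoc_mult_mat[OF A M' carrier(2)])
  also have "a \<cdot>\<^sub>m 1\<^sub>m n * A = A * (a \<cdot>\<^sub>m 1\<^sub>m m)"
    using A by (simp add: mult_smult_distrib[OF A, of _ m] mult_smult_assoc_mat[of _ n n A])
  also have "A * (a \<cdot>\<^sub>m 1\<^sub>m m) + A * (M' * ?Y') = A * poly_mat (pCons a p) M'"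
    unfolding poly_mat_pCons[OF M']
    by (rule mult_add_distrib_mat[OF A _ mult_carrier_mat[OF M' carrier(2)], symmetric]) simp
  finally show ?case .
qed

lemma poly_mat_map:
  assumes "comm_ring_hom h" "M \<in> carrier_mat n n"
  shows "poly_mat (map_poly h p) (map_mat h M) = map_mat h (poly_mat p M)"
proof -
  interpret comm_ring_hom h by fact
  have hM: "map_mat h M \<in> carrier_mat n n" using assms(2) by simp
  show ?thesis
  proof (induction p)
    case 0
    show ?case unfolding map_poly_0 poly_mat_0[OF hM] poly_mat_0[OF assms(2)]
      by (auto intro!: eq_matI)
  next
    case (pCons a p)
    have "map_mat h (M * poly_mat p M) = map_mat h M * map_mat h (poly_mat p M)"
      using assms(2) poly_mat_carrier[OF assms(2)] by (rule mat_hom_mult)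
    moreover have "map_poly h (pCons a p) = pCons (h a) (map_poly h p)"
      by (rule poly_eqI) (simp add: coeff_map_poly coeff_pCons split: nat.split)
    ultimately have "poly_mat (map_poly h (pCons a p)) (map_mat h M) =
        h a \<cdot>\<^sub>m 1\<^sub>m n + map_mat h (M * poly_mat p M)"
      using pCons by (simp add: poly_mat_pCons[OF hM])
    also have "\<dots> = map_mat h (poly_mat (pCons a p) M)"
      unfolding poly_mat_pCons[OF assms(2)]
      using assms(2)
      by (intro eq_matI) (auto simp del: index_mult_mat(1) simp: hom_distribs poly_mat_dim[OF assms(2)])
    finally show ?case .
  qed
qed

lemma poly_mat_transpose:
  assumes M: "M \<in> carrier_mat n n"
  shows "poly_mat p (transpose_mat M) = transpose_mat (poly_mat p M)"
proof (induction p)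
  case 0
  show ?case using M by (simp add: poly_mat_0[of _ n])
next
  case (pCons a p)
  have "M * poly_mat p M = poly_mat p M * M"
    using poly_mat_intertwine[OF M M M refl] by simp
  then have "transpose_mat (M * poly_mat p M) = transpose_mat M * transpose_mat (poly_mat p M)"
    using transpose_mult[OF poly_mat_carrier[OF M] M] by metis
  then show ?case using pCons M poly_mat_carrier[OF M, of p]
    by (simp add: poly_mat_pCons[of _ n] transpose_add[of _ n n] mult_carrier_mat[OF M])
      (auto intro!: eq_matI simp: poly_mat_dim[OF M] carrier_matD[OF M])
qed

text \<open>
  The \<open>n\<^sup>2 + 1\<close> powers of \<open>M\<close> up to the exponent \<open>n\<^sup>2\<close> are linearly dependent. A linear relation is
  a kernel vector of the matrix whose columns are the flattened powers, made square and singular by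
  an additional zero row.
\<close>
lemma annihilating_poly_exists:
  fixes M :: "'a :: field mat"
  assumes M: "M \<in> carrier_mat n n"
  obtains p where "p \<noteq> 0" "poly_mat p M = 0\<^sub>m n n"
proof -
  define N where "N = n * n + 1"
  define W :: "'a mat" where
    "W = mat N N (\<lambda>(r, k). if r < n * n then poly_mat (monom 1 k) M $$ (r div n, r mod n) else 0)"
  have W: "W \<in> carrier_mat N N" by (simp add: W_def)
  have "\<forall>k<N. W $$ (n * n, k) = 0" by (simp add: W_def N_def)
  then have "det W = 0"
    by (subst laplace_expansion_row[OF W, of "n * n"]) (simp_all add: N_def)
  then obtain v where v: "v \<in> carrier_vec N" "v \<noteq> 0\<^sub>v N" "W *\<^sub>v v = 0\<^sub>v N"
    using det_0_iff_vec_prod_zero_field[OF W] by blast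
  define p where "p = (\<Sum>k<N. smult (v $ k) (monom 1 k))"
  have coeff_p: "coeff p k = v $ k" if "k < N" for k
    using that by (simp add: p_def coeff_sum smult_monom coeff_monom)
  show ?thesis
  proof
    show "p \<noteq> 0" using v(1,2) coeff_p by auto
    show "poly_mat p M = 0\<^sub>m n n"
    proof (rule eq_matI)
      fix i j assume "i < dim_row (0\<^sub>m n n)" "j < dim_col (0\<^sub>m n n)"
      then have ij: "i < n" "j < n" by auto
      have "i * n + j < Suc i * n" using ij by simp
      also have "\<dots> \<le> n * n" using ij by (intro mult_le_mono1) simp
      finally have r: "i * n + j < n * n" "i * n + j < N" by (auto simp: N_def)
      have "0 = (W *\<^sub>v v) $ (i * n + j)" using v r by simp
      also have "\<dots> = (\<Sum>k<N. poly_mat (monom 1 k) M $$ (i, j) * v $ k)"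
        using r v(1) ij W by (simp add: scalar_prod_def W_def atLeast0LessThan)
      also have "\<dots> = poly_mat p M $$ (i, j)"
        using ij
        by (simp add: p_def poly_mat_dim[OF M] poly_mat_sum_index[OF M] poly_mat_smult[OF M] mult.commute del: smult_monom)
      finally show "poly_mat p M $$ (i, j) = 0\<^sub>m n n $$ (i, j)" using ij by simp
    qed (use poly_mat_carrier[OF M] in auto)
  qed
qed

lemma smult_zero_one_mat: "(0 :: 'a :: semiring_1) \<cdot>\<^sub>m 1\<^sub>m n = 0\<^sub>m n n"
  by (intro eq_matI) auto

text \<open>
  Powers of the variable can be cancelled from an annihilating polynomial of an invertible matrix.
\<close>
lemma annihilating_poly_nonzero_constant:
  fixes M :: "'a :: field mat"
  assumes M: "M \<in> carrier_mat n n" and inv: "M' \<in> carrier_mat n n" "M' * M = 1\<^sub>m n"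
  obtains p where "poly p 0 \<noteq> 0" "poly_mat p M = 0\<^sub>m n n"
proof -
  have "\<exists>p. poly p 0 \<noteq> 0 \<and> poly_mat p M = 0\<^sub>m n n"
    if "q \<noteq> 0" "poly_mat q M = 0\<^sub>m n n" for q
    using that
  proof (induction q)
    case (pCons a q)
    show ?case
    proof (cases "a = 0")
      case True
      then have "M * poly_mat q M = 0\<^sub>m n n"
        using pCons.prems by (metis poly_mat_pCons[OF M] mult_carrier_mat[OF M poly_mat_carrier[OF M]]
            left_add_zero_mat smult_zero_one_mat)
      then have "M' * (M * poly_mat q M) = 0\<^sub>m n n" using inv by simp
      then have "poly_mat q M = 0\<^sub>m n n"
        using inv poly_mat_carrier[OF M, of q]
        by (simp add: assoc_mult_mat[OF inv(1) M poly_mat_carrier[OF M], symmetric])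
      then show ?thesis using pCons True by auto
    next
      case False
      then show ?thesis using pCons.prems by (intro exI[of _ "pCons a q"]) simp
    qed
  qed simp
  then show ?thesis using annihilating_poly_exists[OF M] that by blast
qed

section \<open>Polynomial square roots of a nonsingular matrix\<close>

lemma nonsingularE:
  assumes "S \<in> nonsingular_mats n"
  obtains S' where "S \<in> carrier_mat n n" "S' \<in> carrier_mat n n" "S * S' = 1\<^sub>m n" "S' * S = 1\<^sub>m n"
proof -
  obtain S' where S: "S \<in> carrier_mat n n" and S': "S * S' = 1\<^sub>m (dim_row S)" "S' * S = 1\<^sub>m (dim_row S')"
    using assms by (auto simp: nonsingular_mats_def invertible_mat_def inverts_mat_def)
  have "dim_col S' = n" using S S'(1) by (metis carrier_matD(1) index_mult_mat(3) index_one_mat(3))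
  moreover have "dim_row S' = n" using S S'(2) by (metis carrier_matD(2) index_mult_mat(3) index_one_mat(3))
  ultimately show ?thesis using S S' that[of S'] by auto
qed

lemma nonsingularI:
  assumes "S \<in> carrier_mat n n" "S' \<in> carrier_mat n n" "S * S' = 1\<^sub>m n" "S' * S = 1\<^sub>m n"
  shows "S \<in> nonsingular_mats n"
  using assms by (auto simp: nonsingular_mats_def invertible_mat_def inverts_mat_def square_mat.simps)

text \<open>
  The set \<open>Z\<close> consists of the roots of an annihilating polynomial together with their conjugates, so
  that real polynomials can be interpolated on it; the nodes are nonzero because \<open>M\<close> is nonsingular.
\<close>
lemma annihilating_power_of_linear_prod:
  fixes M :: "'a :: alg_closed_field mat"
  assumes "field_involution \<sigma>" and M: "M \<in> nonsingular_mats n"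
  obtains Z k where "finite Z" "0 \<notin> Z" "\<And>z. z \<in> Z \<Longrightarrow> \<sigma> z \<in> Z"
    "poly_mat ((\<Prod>z\<in>Z. [:- z, 1:]) ^ k) M = 0\<^sub>m n n"
proof -
  interpret field_involution \<sigma> by fact
  obtain M' where M': "M \<in> carrier_mat n n" "M' \<in> carrier_mat n n" "M' * M = 1\<^sub>m n"
    using M by (elim nonsingularE)
  obtain p where p: "poly p 0 \<noteq> 0" "poly_mat p M = 0\<^sub>m n n"
    using annihilating_poly_nonzero_constant[OF M'] by blast
  then have "p \<noteq> 0" by auto
  define Z where "Z = {z. poly p z = 0} \<union> \<sigma> ` {z. poly p z = 0}"
  have Z: "finite Z" using poly_roots_finite[OF \<open>p \<noteq> 0\<close>] by (simp add: Z_def)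
  show ?thesis
  proof
    show "finite Z" by fact
    show "0 \<notin> Z" using p by (auto simp: Z_def)
    show "\<sigma> z \<in> Z" if "z \<in> Z" for z using that by (auto simp: Z_def)
    have "p dvd (\<Prod>z\<in>Z. [:- z, 1:]) ^ degree p - 0"
      using poly_dvd_power_of_linear_prod[OF \<open>p \<noteq> 0\<close> Z] by (simp add: Z_def)
    then show "poly_mat ((\<Prod>z\<in>Z. [:- z, 1:]) ^ degree p) M = 0\<^sub>m n n"
      using poly_mat_cong_dvd[OF M'(1) _ p(2)] poly_mat_0[OF M'(1)] by metis
  qed
qed

lemma id_field_involution: "field_involution (id :: 'a :: field \<Rightarrow> 'a)"
  by unfold_locales (simp add: involution_def mult.commute)

lemma alg_closed_matrix_sqrt:
  fixes M :: "'a :: alg_closed_field mat"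
  assumes two: "(2 :: 'a) \<noteq> 0" and M: "M \<in> nonsingular_mats n"
  shows "\<exists>f. poly_mat f M * poly_mat f M = M"
proof -
  interpret field_involution "id :: 'a \<Rightarrow> 'a" by (rule id_field_involution)
  have Mc: "M \<in> carrier_mat n n" using M by (elim nonsingularE)
  obtain Z k where Z: "finite Z" "0 \<notin> Z" "\<And>z. z \<in> Z \<Longrightarrow> id z \<in> Z"
    and k: "poly_mat ((\<Prod>z\<in>Z. [:- z, 1:]) ^ k) M = 0\<^sub>m n n"
    using annihilating_power_of_linear_prod[OF id_field_involution M] by blast
  define s where "s x = (SOME y :: 'a. y ^ 2 = x)" for x
  have s: "s x ^ 2 = x" for x
    unfolding s_def by (rule someI_ex) (use nth_root_exists[of 2 x] in simp)
  obtain f where "(\<Prod>z\<in>Z. [:- z, 1:]) ^ k dvd f ^ 2 - [:0, 1:]"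
  proof (rule real_square_root_exists[OF two Z(1,3), of s "[:0, 1:]"])
    show "s z \<noteq> 0" if "z \<in> Z" for z using s[of z] Z(2) that by auto
  qed (auto simp: s X_real_poly)
  then have "poly_mat (f ^ 2) M = poly_mat [:0, 1:] M"
    using poly_mat_cong_dvd[OF Mc _ k] by blast
  then have "poly_mat f M * poly_mat f M = M"
    by (simp add: power2_eq_square poly_mat_mult[OF Mc] poly_mat_X[OF Mc])
  then show ?thesis ..
qed

text \<open>
  Choose \<open>\<epsilon>\<close> and \<open>s\<close> with \<open>s\<^sup>2 = \<epsilon> x\<close> as above. A square root \<open>e\<close> of \<open>1\<close> with values \<open>\<epsilon>\<close> at the
  nodes and then a square root \<open>f\<close> of \<open>e x\<close> with values \<open>s\<close> give \<open>e f\<^sup>2 = e\<^sup>2 x = x\<close> modulo an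
  annihilating polynomial. Thus \<open>M\<close> is the square of a real polynomial in \<open>M\<close> up to the involutory
  factor \<open>e(M)\<close>, which records the negative part of the spectrum.
\<close>
lemma (in alg_closed_involution) signed_real_matrix_sqrt:
  assumes M: "M \<in> nonsingular_mats n"
  shows "\<exists>e\<in>real_polys. \<exists>f\<in>real_polys. poly_mat e M * poly_mat e M = 1\<^sub>m n \<and>
    poly_mat f M * poly_mat e M * poly_mat f M = M"
proof -
  have Mc: "M \<in> carrier_mat n n" using M by (elim nonsingularE)
  obtain Z k where Z: "finite Z" "0 \<notin> Z" "\<And>z. z \<in> Z \<Longrightarrow> \<sigma> z \<in> Z"
    and k: "poly_mat ((\<Prod>z\<in>Z. [:- z, 1:]) ^ k) M = 0\<^sub>m n n"
    using annihilating_power_of_linear_prod[OF field_involution_axioms M] by blast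
  define \<omega> where "\<omega> = (\<Prod>z\<in>Z. [:- z, 1:])"
  obtain s \<epsilon> where s: "\<And>x. x \<noteq> 0 \<Longrightarrow> s x ^ 2 = \<epsilon> x * x" "\<And>x. x \<noteq> 0 \<Longrightarrow> \<epsilon> x = 1 \<or> \<epsilon> x = - 1"
    "\<And>x. x \<noteq> 0 \<Longrightarrow> s (\<sigma> x) = \<sigma> (s x)" "\<And>x. x \<noteq> 0 \<Longrightarrow> \<epsilon> (\<sigma> x) = \<epsilon> x"
    by (rule equivariant_signed_sqrt, rule that)
  have nz: "x \<noteq> 0" if "x \<in> Z" for x using that Z by auto
  have \<epsilon>_real: "\<sigma> (\<epsilon> z) = \<epsilon> z" if "z \<in> Z" for z
    using s(2)[OF nz[OF that]] by (auto simp: hom_distribs)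
  obtain e where e: "e \<in> real_polys" "\<And>z. z \<in> Z \<Longrightarrow> poly e z = \<epsilon> z" "\<omega> ^ k dvd e ^ 2 - 1"
  proof (rule real_square_root_exists[OF two_neq_0 Z(1,3), of \<epsilon> 1 k, folded \<omega>_def])
    fix z assume z: "z \<in> Z"
    show "\<epsilon> (\<sigma> z) = \<sigma> (\<epsilon> z)" using s(4) nz \<epsilon>_real z by simp
    show "\<epsilon> z \<noteq> 0" "poly 1 z = (\<epsilon> z)\<^sup>2" using s(2)[OF nz[OF z]] by auto
  qed (auto simp: one_real_poly)
  have eX: "e * [:0, 1:] \<in> real_polys" by (rule real_polys_closed(3)[OF e(1) X_real_poly])
  obtain f where f: "f \<in> real_polys" "\<omega> ^ k dvd f ^ 2 - e * [:0, 1:]"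
  proof (rule real_square_root_exists[OF two_neq_0 Z(1,3), of s "e * [:0, 1:]" k, folded \<omega>_def])
    fix z assume z: "z \<in> Z"
    show "s (\<sigma> z) = \<sigma> (s z)" using s(3) nz z by simp
    have "s z ^ 2 \<noteq> 0" using s(1,2)[OF nz[OF z]] nz[OF z] by auto
    then show "s z \<noteq> 0" by auto
    show "poly (e * [:0, 1:]) z = (s z)\<^sup>2" using s(1)[OF nz[OF z]] e(2)[OF z] by simp
  qed (use eX in auto)
  have ee: "poly_mat (e ^ 2) M = poly_mat 1 M"
    by (rule poly_mat_cong_dvd[OF Mc e(3) k[folded \<omega>_def]])
  have "poly_mat (f * e * f) M = poly_mat (e * f ^ 2) M" by (simp add: power2_eq_square mult_ac)
  also have "\<dots> = poly_mat e M * poly_mat (e * [:0, 1:]) M"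
    using poly_mat_cong_dvd[OF Mc f(2) k[folded \<omega>_def]] by (simp only: poly_mat_mult[OF Mc])
  also have "\<dots> = poly_mat (e ^ 2) M * poly_mat [:0, 1:] M"
    by (simp only: poly_mat_mult[OF Mc, symmetric] power2_eq_square mult.assoc)
  also have "\<dots> = M" unfolding ee poly_mat_1[OF Mc] poly_mat_X[OF Mc] using Mc by simp
  finally have "poly_mat f M * poly_mat e M * poly_mat f M = M" by (simp only: poly_mat_mult[OF Mc])
  moreover have "poly_mat e M * poly_mat e M = 1\<^sub>m n"
    using ee by (simp only: power2_eq_square poly_mat_mult[OF Mc] poly_mat_1[OF Mc])
  ultimately show ?thesis using e(1) f(1) by blast
qed

section \<open>Real closed fields\<close>

text \<open>
  The closure has a basis \<open>1, \<theta>\<close> over the field, where \<open>\<theta>\<^sup>2 = c + b \<theta>\<close>, and the conjugation sends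
  \<open>\<theta>\<close> to the other root \<open>b - \<theta>\<close>. It fixes no further elements as soon as the two roots differ. They
  would coincide only in characteristic two with \<open>b = 0\<close>; then the square of any \<open>u + v \<theta>\<close> is
  \<open>u\<^sup>2 + v\<^sup>2 \<theta>\<^sup>2\<close>, which lies in the field, although \<open>\<theta>\<close> must be the square of some element.
\<close>
lemma real_closed_conjugation:
  assumes "real_closed_field TYPE('a :: field)"
  obtains \<sigma> :: "('a :: field) alg_closure \<Rightarrow> 'a alg_closure"
    where "alg_closed_involution \<sigma>" "\<And>x. \<sigma> x = x \<Longrightarrow> x \<in> range to_ac"
proof -
  interpret vs: vector_space "\<lambda>(c :: 'a) (x :: 'a alg_closure). to_ac c * x"
    by (rule vector_space_alg_closure)
  have dim: "vs.dim UNIV = 2" using assms by (simp add: real_closed_field_def)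
  have "vs.independent {1}" by (simp add: vs.dependent_single)
  then obtain B where B: "{1} \<subseteq> B" "vs.independent B" "vs.span B = UNIV"
    using vs.extend_basis_superset vs.independent_extend_basis vs.span_extend_basis by metis
  have "card B = 2" using vs.basis_card_eq_dim[of B UNIV] B dim by simp
  then obtain \<theta> where \<theta>: "B = {1, \<theta>}" "\<theta> \<noteq> 1"
    using B(1) by (auto simp: card_2_iff)
  define R where "R = range (to_ac :: 'a \<Rightarrow> _)"
  have R: "x + y \<in> R" "x - y \<in> R" "x * y \<in> R" "x / y \<in> R" "- x \<in> R" "0 \<in> R" "1 \<in> R"
    if "x \<in> R" "y \<in> R" for x y
    using that unfolding R_def
    by (auto simp flip: to_ac_add to_ac_diff to_ac_mult to_ac_divide to_ac_minus to_ac_0 to_ac_1)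
  have ex: "\<exists>u\<in>R. \<exists>v\<in>R. x = u + v * \<theta>" for x
  proof -
    have "x \<in> vs.span (insert 1 {\<theta>})" using B \<theta> by simp
    then obtain a where "x - to_ac a * 1 \<in> vs.span {\<theta>}" by (rule vs.span_breakdown_eq[THEN iffD1, THEN exE])
    then obtain b where "x - to_ac a = to_ac b * \<theta>" by (auto simp: vs.span_singleton)
    then show ?thesis unfolding R_def by (metis add.commute diff_add_cancel rangeI)
  qed
  have \<theta>R: "\<theta> \<notin> R"
  proof
    assume "\<theta> \<in> R"
    then obtain a where "\<theta> = to_ac a * 1" by (auto simp: R_def)
    then have "\<theta> \<in> vs.span {1}" by (simp add: vs.span_singleton)
    moreover have "\<theta> \<notin> vs.span (B - {\<theta>})"
      using B(2) \<theta> by (auto simp: vs.dependent_def)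
    moreover have "B - {\<theta>} = {1}" using \<theta> by auto
    ultimately show False by simp
  qed
  have uniq: "u = u' \<and> v = v'" if "u + v * \<theta> = u' + v' * \<theta>" "u \<in> R" "v \<in> R" "u' \<in> R" "v' \<in> R" for u v u' v'
  proof (cases "v = v'")
    case False
    then have "\<theta> = (u' - u) / (v - v')" using that(1) by (simp add: field_simps)
    then show ?thesis using that \<theta>R R by metis
  qed (use that in auto)
  obtain c b where bc: "b \<in> R" "c \<in> R" "\<theta> * \<theta> = c + b * \<theta>" using ex by blast
  have nz: "b \<noteq> 2 * \<theta>"
  proof
    assume b: "b = 2 * \<theta>"
    have two: "(2 :: 'a alg_closure) = 0"
    proof (rule ccontr)
      assume "(2 :: 'a alg_closure) \<noteq> 0"
      then have "\<theta> = b / (1 + 1)" using b by simp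
      then show False using \<theta>R R bc by metis
    qed
    have c: "\<theta> * \<theta> \<in> R" using bc b two by simp
    obtain w where w: "w ^ 2 = \<theta>" using nth_root_exists[of 2 \<theta>] by auto
    obtain u v where uv: "u \<in> R" "v \<in> R" "w = u + v * \<theta>" using ex by blast
    have "w ^ 2 = u * u + v * v * (\<theta> * \<theta>) + 2 * (u * v * \<theta>)"
      unfolding uv(3) power2_eq_square by (simp add: algebra_simps)
    then have "\<theta> = u * u + v * v * (\<theta> * \<theta>)" unfolding w two by simp
    then show False using \<theta>R R c uv by metis
  qed
  define u v where "u x = (SOME u. u \<in> R \<and> (\<exists>v\<in>R. x = u + v * \<theta>))"
    and "v x = (SOME v. v \<in> R \<and> x = u x + v * \<theta>)" for x
  have u: "u x \<in> R \<and> (\<exists>v\<in>R. x = u x + v * \<theta>)" for x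
    unfolding u_def by (rule someI_ex) (use ex in blast)
  have v: "v x \<in> R \<and> x = u x + v x * \<theta>" for x
    unfolding v_def by (rule someI_ex) (use u in blast)
  define \<sigma> where "\<sigma> x = u x + v x * (b - \<theta>)" for x
  have \<sigma>: "\<sigma> (p + q * \<theta>) = p + q * (b - \<theta>)" if "p \<in> R" "q \<in> R" for p q
    using uniq[of p q "u (p + q * \<theta>)" "v (p + q * \<theta>)"] u v that by (simp add: \<sigma>_def)
  have cases: "\<exists>p q. p \<in> R \<and> q \<in> R \<and> x = p + q * \<theta> \<and> \<sigma> x = p + q * (b - \<theta>)" for x
    using ex[of x] \<sigma> by blast
  have add: "\<sigma> (x + y) = \<sigma> x + \<sigma> y" for x y
  proof -
    obtain p q p' q' where *: "p \<in> R" "q \<in> R" "x = p + q * \<theta>" "\<sigma> x = p + q * (b - \<theta>)"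
      "p' \<in> R" "q' \<in> R" "y = p' + q' * \<theta>" "\<sigma> y = p' + q' * (b - \<theta>)"
      using cases[of x] cases[of y] by blast
    then have "x + y = (p + p') + (q + q') * \<theta>" by (simp add: algebra_simps)
    then have "\<sigma> (x + y) = (p + p') + (q + q') * (b - \<theta>)" using \<sigma> R * by metis
    then show ?thesis unfolding *(4,8) by (simp add: algebra_simps)
  qed
  have mult: "\<sigma> (x * y) = \<sigma> x * \<sigma> y" for x y
  proof -
    obtain p q p' q' where *: "p \<in> R" "q \<in> R" "x = p + q * \<theta>" "\<sigma> x = p + q * (b - \<theta>)"
      "p' \<in> R" "q' \<in> R" "y = p' + q' * \<theta>" "\<sigma> y = p' + q' * (b - \<theta>)"
      using cases[of x] cases[of y] by blast
    have "x * y = p * p' + (p * q' + q * p') * \<theta> + q * q' * (\<theta> * \<theta>)"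
      by (simp add: * algebra_simps)
    also have "\<dots> = (p * p' + q * q' * c) + (p * q' + q * p' + q * q' * b) * \<theta>"
      unfolding bc(3) by (simp add: algebra_simps)
    finally have "\<sigma> (x * y) = (p * p' + q * q' * c) + (p * q' + q * p' + q * q' * b) * (b - \<theta>)"
      using \<sigma> R * bc(1,2) by metis
    moreover have conj: "(b - \<theta>) * (b - \<theta>) = c + b * (b - \<theta>)"
    proof -
      have "(b - \<theta>) * (b - \<theta>) = b * b - 2 * b * \<theta> + \<theta> * \<theta>" by (simp add: algebra_simps)
      then show ?thesis unfolding bc(3) by (simp add: algebra_simps)
    qed
    have "\<sigma> x * \<sigma> y = p * p' + (p * q' + q * p') * (b - \<theta>) + q * q' * ((b - \<theta>) * (b - \<theta>))"
      unfolding *(4,8) by (simp add: algebra_simps)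
    then have "\<sigma> x * \<sigma> y = (p * p' + q * q' * c) + (p * q' + q * p' + q * q' * b) * (b - \<theta>)"
      unfolding conj by (simp add: algebra_simps)
    ultimately show ?thesis by simp
  qed
  have invol: "\<sigma> (\<sigma> x) = x" for x
  proof -
    obtain p q where *: "p \<in> R" "q \<in> R" "x = p + q * \<theta>" "\<sigma> x = p + q * (b - \<theta>)"
      using cases[of x] by blast
    have "\<sigma> x = (p + q * b) + (- q) * \<theta>" using * by (simp add: algebra_simps)
    then have "\<sigma> (\<sigma> x) = (p + q * b) + (- q) * (b - \<theta>)" using \<sigma> R * bc(1,2) by metis
    then show ?thesis using * by (simp add: algebra_simps)
  qed
  have fixed: "x \<in> R" if "\<sigma> x = x" for x
  proof -
    obtain p q where *: "p \<in> R" "q \<in> R" "x = p + q * \<theta>" "\<sigma> x = p + q * (b - \<theta>)"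
      using cases[of x] by blast
    then have "q * (b - 2 * \<theta>) = 0" using that by (auto simp: algebra_simps)
    then show ?thesis using nz * by simp
  qed
  have "bij \<sigma>" using invol by (metis bijI' )
  then have "involution \<sigma>" using add mult invol by (simp add: involution_def mult.commute)
  moreover have "\<sigma> \<noteq> id" using fixed[of \<theta>] \<theta>R by auto
  ultimately have "alg_closed_involution \<sigma>" by unfold_locales
  then show ?thesis using fixed that unfolding R_def by blast
qed

lemma real_closed_two_neq_0:
  assumes "real_closed_field TYPE('a :: field)" shows "(2 :: 'a) \<noteq> 0"
proof -
  obtain \<sigma> :: "'a alg_closure \<Rightarrow> 'a alg_closure" where "alg_closed_involution \<sigma>"
    using real_closed_conjugation[OF assms] by blast
  then have "to_ac (2 :: 'a) \<noteq> 0" using alg_closed_involution.two_neq_0 by simp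
  then show ?thesis by (metis to_ac_0)
qed

lemma to_ac_comm_ring_hom: "comm_ring_hom (to_ac :: 'a :: field \<Rightarrow> _)"
  by unfold_locales simp_all

text \<open>
  Over the algebraic closure the polynomials can be chosen with coefficients fixed by the conjugation,
  that is with coefficients in the field itself, so the identities already hold over the field.
\<close>
lemma real_closed_signed_matrix_sqrt:
  fixes M :: "'a :: field mat"
  assumes F: "real_closed_field TYPE('a)" and M: "M \<in> nonsingular_mats n"
  shows "\<exists>e f. poly_mat e M * poly_mat e M = 1\<^sub>m n \<and>
    poly_mat f M * poly_mat e M * poly_mat f M = M"
proof -
  obtain \<sigma> :: "'a alg_closure \<Rightarrow> 'a alg_closure"
    where \<sigma>: "alg_closed_involution \<sigma>" and real: "\<And>x. \<sigma> x = x \<Longrightarrow> x \<in> range to_ac"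
    using real_closed_conjugation[OF F] by blast
  interpret alg_closed_involution \<sigma> by fact
  interpret ac: comm_ring_hom "to_ac :: 'a \<Rightarrow> _" by (rule to_ac_comm_ring_hom)
  obtain M' where M': "M \<in> carrier_mat n n" "M' \<in> carrier_mat n n" "M * M' = 1\<^sub>m n" "M' * M = 1\<^sub>m n"
    using M by (elim nonsingularE)
  have "map_mat to_ac M \<in> nonsingular_mats n"
  proof (rule nonsingularI)
    show "map_mat to_ac M * map_mat to_ac M' = 1\<^sub>m n" "map_mat to_ac M' * map_mat to_ac M = 1\<^sub>m n"
      using M' by (simp_all flip: ac.mat_hom_mult add: ac.mat_hom_one)
  qed (use M' in auto)
  then obtain e f where ef: "e \<in> real_polys" "f \<in> real_polys"
    "poly_mat e (map_mat to_ac M) * poly_mat e (map_mat to_ac M) = 1\<^sub>m n"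
    "poly_mat f (map_mat to_ac M) * poly_mat e (map_mat to_ac M) * poly_mat f (map_mat to_ac M) = map_mat to_ac M"
    using signed_real_matrix_sqrt by blast
  have descend: "\<exists>g. poly_mat q (map_mat to_ac M) = map_mat to_ac (poly_mat g M)" if "q \<in> real_polys" for q
  proof -
    have "\<sigma> (coeff q k) = coeff q k" for k
      using that by (metis (mono_tags) coeff_map_poly hom_zero mem_Collect_eq real_polys_def)
    then have "to_ac (of_ac (coeff q k)) = coeff q k" for k using real to_ac_of_ac by blast
    then have "q = map_poly to_ac (map_poly of_ac q)"
      by (intro poly_eqI) (simp add: coeff_map_poly of_ac_eqI)
    then show ?thesis using poly_mat_map[OF to_ac_comm_ring_hom M'(1)] by metis
  qed
  obtain e' where e': "poly_mat e (map_mat to_ac M) = map_mat to_ac (poly_mat e' M)"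
    using descend ef(1) by blast
  obtain f' where f': "poly_mat f (map_mat to_ac M) = map_mat to_ac (poly_mat f' M)"
    using descend ef(2) by blast
  note [simp] = poly_mat_carrier[OF M'(1)]
  have hom: "map_mat to_ac A * map_mat to_ac B = map_mat to_ac (A * B)"
    if "A \<in> carrier_mat n n" "B \<in> carrier_mat n n" for A B :: "'a mat"
    using ac.mat_hom_mult[OF that] by simp
  have inj: "A = B" if "map_mat to_ac A = map_mat to_ac B" for A B :: "'a mat"
    using that by (auto simp: mat_eq_iff)
  have "map_mat to_ac (poly_mat e' M * poly_mat e' M) = map_mat to_ac (1\<^sub>m n)"
    using ef(3) by (simp add: e' hom ac.mat_hom_one)
  moreover have "map_mat to_ac (poly_mat f' M * poly_mat e' M * poly_mat f' M) = map_mat to_ac M"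
    using ef(4) by (simp add: e' f' hom mult_carrier_mat[of _ n n])
  ultimately show ?thesis using inj by blast
qed

section \<open>Involutory matrices\<close>

lemma signature_mat_eq_diag:
  "signature_mat p q = mat_diag (p + q) (\<lambda>i. if i < p then 1 else - 1)"
  by (rule eq_matI) (auto simp: signature_mat_def block_diag_def mat_diag_def)

lemma signature_mat_carrier: "p \<le> n \<Longrightarrow> signature_mat p (n - p) \<in> carrier_mat n n"
  by (simp add: signature_mat_eq_diag)

text \<open>
  If \<open>w\<close> has a nonzero entry in row \<open>k\<close>, replacing the unit vector \<open>e\<^sub>k\<close> in the standard basis by
  \<open>w\<close> gives a basis. The transposition \<open>\<pi>\<close> of \<open>0\<close> and \<open>k\<close> moves \<open>w\<close> into the first column.
\<close>
lemma nonsingular_with_first_column: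
  fixes w :: "'a :: field vec"
  assumes w: "w \<in> carrier_vec (Suc n)" "w \<noteq> 0\<^sub>v (Suc n)"
  obtains P where "P \<in> nonsingular_mats (Suc n)" "col P 0 = w"
proof -
  obtain k where k: "k < Suc n" "w $ k \<noteq> 0" using w by (metis carrier_vecD eq_vecI index_zero_vec)
  define \<pi> where "\<pi> i = (if i = 0 then k else if i = k then 0 else i)" for i
  define P where "P = mat (Suc n) (Suc n) (\<lambda>(i, j). if j = 0 then w $ i else if j = \<pi> i then 1 else 0)"
  have P: "P \<in> carrier_mat (Suc n) (Suc n)" by (simp add: P_def)
  have entry: "(P *\<^sub>v v) $ i = w $ i * v $ 0 + (if \<pi> i = 0 then 0 else v $ (\<pi> i))"
    if "v \<in> carrier_vec (Suc n)" "i < Suc n" for v i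
  proof -
    have \<pi>: "\<pi> i < Suc n" using that k by (simp add: \<pi>_def)
    have "(P *\<^sub>v v) $ i = (\<Sum>j<Suc n. (if j = 0 then w $ i * v $ 0 else 0) +
        (if j = \<pi> i then (if \<pi> i = 0 then 0 else v $ (\<pi> i)) else 0))"
      unfolding index_mult_mat_vec[of i P v, unfolded carrier_matD(1)[OF P], OF that(2)] scalar_prod_def
        carrier_vecD[OF that(1)] atLeast0LessThan
      using that(2) by (intro sum.cong) (auto simp: P_def)
    then show ?thesis using \<pi> by (simp add: sum.distrib del: sum.lessThan_Suc)
  qed
  have "det P \<noteq> 0"
  proof
    assume "det P = 0"
    then obtain v where v: "v \<in> carrier_vec (Suc n)" "v \<noteq> 0\<^sub>v (Suc n)" "P *\<^sub>v v = 0\<^sub>v (Suc n)"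
      using det_0_iff_vec_prod_zero_field[OF P] by blast
    have "(P *\<^sub>v v) $ k = 0" using v k by simp
    then have v0: "v $ 0 = 0" using entry[OF v(1) k(1)] k by (simp add: \<pi>_def split: if_splits)
    have "v $ j = 0" if j: "j < Suc n" for j
    proof (cases "j = 0")
      case False
      have \<pi>j: "\<pi> j < Suc n" "\<pi> (\<pi> j) = j" using j k by (auto simp: \<pi>_def)
      then have "(P *\<^sub>v v) $ \<pi> j = 0" using v by simp
      then show ?thesis using entry[OF v(1) \<pi>j(1)] v0 \<pi>j False by simp
    qed (use v0 in simp)
    then show False using v(1,2) by (metis carrier_vecD eq_vecI index_zero_vec)
  qed
  then have "P \<in> Units (ring_mat TYPE('a) (Suc n) ())" by (rule det_non_zero_imp_unit[OF P])
  then have "P \<in> nonsingular_mats (Suc n)"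
    using P by (auto simp: Units_def ring_mat_def intro: nonsingularI)
  moreover have "col P 0 = w" using w by (intro eq_vecI) (auto simp: P_def)
  ultimately show ?thesis using that by blast
qed

text \<open>
  Since \<open>B\<^sup>2 = 1\<close>, the block form of \<open>B\<close> with first row \<open>(1, b)\<close> and lower right block \<open>E'\<close> satisfies
  \<open>b + b E' = 0\<close>. Conjugation by the unipotent matrix with upper right block \<open>y = b / 2\<close> therefore
  removes \<open>b\<close>.
\<close>
lemma involutory_mat_unit_block:
  fixes B :: "'a :: field mat"
  assumes two: "(2 :: 'a) \<noteq> 0" and B: "B \<in> carrier_mat (Suc n) (Suc n)" "B * B = 1\<^sub>m (Suc n)"
    and col: "col B 0 = unit_vec (Suc n) 0"
  obtains E' where "E' \<in> carrier_mat n n" "E' * E' = 1\<^sub>m n"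
    "similar_mat B (four_block_mat (1\<^sub>m 1) (0\<^sub>m 1 n) (0\<^sub>m n 1) E')"
proof -
  define b where "b = mat 1 n (\<lambda>(i, j). B $$ (0, Suc j))"
  define E' where "E' = mat n n (\<lambda>(i, j). B $$ (Suc i, Suc j))"
  have c: "b \<in> carrier_mat 1 n" "E' \<in> carrier_mat n n" by (auto simp: b_def E'_def)
  have B0: "B $$ (i, 0) = (if i = 0 then 1 else 0)" if "i < Suc n" for i
    using arg_cong[OF col, of "\<lambda>v. vec_index v i"] that B by (simp add: unit_vec_def)
  have block: "B = four_block_mat (1\<^sub>m 1) b (0\<^sub>m n 1) E'"
    using B by (intro eq_matI) (auto simp: b_def E'_def B0)
  have "B * B = four_block_mat (1\<^sub>m 1) (b + b * E') (0\<^sub>m n 1) (E' * E')"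
    unfolding block using c by (subst mult_four_block_mat[of _ 1 1 _ n _ n _ _ 1 _ n]) auto
  then have eq: "four_block_mat (1\<^sub>m 1) (b + b * E') (0\<^sub>m n 1) (E' * E') = 1\<^sub>m (Suc n)"
    using B by simp
  have E'E': "E' * E' = 1\<^sub>m n"
  proof (rule eq_matI)
    fix i j assume "i < dim_row (1\<^sub>m n)" "j < dim_col (1\<^sub>m n)"
    then show "(E' * E') $$ (i, j) = 1\<^sub>m n $$ (i, j)"
      using arg_cong[OF eq, of "\<lambda>Y. Y $$ (Suc i, Suc j)"] c by (simp del: index_mult_mat(1))
  qed (use c in auto)
  have bE': "b + b * E' = 0\<^sub>m 1 n"
  proof (rule eq_matI)
    fix i j assume "i < dim_row (0\<^sub>m 1 n)" "j < dim_col (0\<^sub>m 1 n)"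
    then show "(b + b * E') $$ (i, j) = 0\<^sub>m 1 n $$ (i, j)"
      using arg_cong[OF eq, of "\<lambda>Y. Y $$ (0, Suc j)"] c by (simp del: index_mult_mat(1))
  qed (use c in auto)
  define y where "y = (1 / 2) \<cdot>\<^sub>m b"
  have y: "y \<in> carrier_mat 1 n" "- y \<in> carrier_mat 1 n" using c by (auto simp: y_def)
  define U V where "U = four_block_mat (1\<^sub>m 1) y (0\<^sub>m n 1) (1\<^sub>m n)"
    and "V = four_block_mat (1\<^sub>m 1) (- y) (0\<^sub>m n 1) (1\<^sub>m n)"
  let ?D = "four_block_mat (1\<^sub>m 1) (0\<^sub>m 1 n) (0\<^sub>m n 1) E'"
  have one: "1\<^sub>m (Suc n) = four_block_mat (1\<^sub>m 1) (0\<^sub>m 1 n) (0\<^sub>m n 1) (1\<^sub>m n :: 'a mat)"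
    using four_block_one_mat[of 1 n] by simp
  have UV: "U * V = 1\<^sub>m (Suc n)"
    unfolding U_def V_def one using y
    by (subst mult_four_block_mat[of _ 1 1 _ n _ n _ _ 1 _ n])
      (simp_all, (intro cong_four_block_mat eq_matI; auto)?)
  have VU: "V * U = 1\<^sub>m (Suc n)"
    unfolding U_def V_def one using y
    by (subst mult_four_block_mat[of _ 1 1 _ n _ n _ _ 1 _ n])
      (simp_all, (intro cong_four_block_mat eq_matI; auto)?)
  have yE': "y * E' = - y"
  proof -
    have "b * E' = - b"
    proof (rule eq_matI)
      fix i j assume "i < dim_row (- b)" "j < dim_col (- b)"
      then show "(b * E') $$ (i, j) = (- b) $$ (i, j)"
        using arg_cong[OF bE', of "\<lambda>Y. Y $$ (i, j)"] c
        by (simp add: eq_neg_iff_add_eq_0 add.commute del: index_mult_mat(1))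
    qed (use c in auto)
    moreover have "(1 / 2) \<cdot>\<^sub>m (- b) = - ((1 / 2) \<cdot>\<^sub>m b)" by (intro eq_matI) auto
    ultimately show ?thesis using c by (simp add: y_def mult_smult_assoc_mat[of _ 1 n _ n])
  qed
  have half: "y + y = b" using c two by (intro eq_matI) (auto simp: y_def field_simps)
  have BV: "V * ?D = four_block_mat (1\<^sub>m 1) y (0\<^sub>m n 1) E'"
    unfolding V_def using y c yE'
    by (subst mult_four_block_mat[of _ 1 1 _ n _ n _ _ 1 _ n])
      (auto intro!: cong_four_block_mat eq_matI)
  have VDU: "B = V * ?D * U"
    unfolding BV unfolding U_def block using y c half
    by (subst mult_four_block_mat[of _ 1 1 _ n _ n _ _ 1 _ n])
      (auto intro!: cong_four_block_mat)
  have "similar_mat_wit B ?D V U"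
  proof (rule similar_mat_witI[OF VU UV VDU B(1)])
    show "?D \<in> carrier_mat (Suc n) (Suc n)" "V \<in> carrier_mat (Suc n) (Suc n)"
      "U \<in> carrier_mat (Suc n) (Suc n)"
      using four_block_carrier_mat[of _ 1 1 _ n n] c(2) by (auto simp: U_def V_def)
  qed
  then show ?thesis using that c E'E' unfolding similar_mat_def by blast
qed

text \<open>
  Unless \<open>E = - 1\<close>, some column of \<open>E + 1\<close> is an eigenvector for the eigenvalue \<open>1\<close>. Splitting it off
  leaves an involutory matrix of smaller size.
\<close>
lemma involutory_mat_similar_signature:
  fixes E :: "'a :: field mat"
  assumes two: "(2 :: 'a) \<noteq> 0"
  shows "E \<in> carrier_mat n n \<Longrightarrow> E * E = 1\<^sub>m n \<Longrightarrow> \<exists>p\<le>n. similar_mat E (signature_mat p (n - p))"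
proof (induction n arbitrary: E)
  case 0
  have "E = signature_mat 0 0" using 0 by (intro eq_matI) (auto simp: signature_mat_eq_diag mat_diag_def)
  then show ?case using 0 similar_mat_refl by auto
next
  case (Suc n)
  note E = Suc.prems
  show ?case
  proof (cases "E = - 1\<^sub>m (Suc n)")
    case True
    then have "E = signature_mat 0 (Suc n)"
      by (intro eq_matI) (auto simp: signature_mat_eq_diag mat_diag_def)
    then show ?thesis using similar_mat_refl[OF E(1)] by auto
  next
    case False
    define G where "G = E + 1\<^sub>m (Suc n)"
    have G: "G \<in> carrier_mat (Suc n) (Suc n)" by (simp add: G_def)
    have "G \<noteq> 0\<^sub>m (Suc n) (Suc n)"
    proof
      assume G0: "G = 0\<^sub>m (Suc n) (Suc n)"
      have "E $$ (i, j) + 1\<^sub>m (Suc n) $$ (i, j) = 0" if "i < Suc n" "j < Suc n" for i j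
        using that E(1) arg_cong[OF G0, of "\<lambda>Y. Y $$ (i, j)"]
        by (simp add: G_def del: index_one_mat(1))
      then have "E = - 1\<^sub>m (Suc n)" using E(1)
        by (intro eq_matI) (auto simp: eq_neg_iff_add_eq_0 simp del: index_one_mat(1))
      then show False using False by simp
    qed
    then obtain i j where ij: "i < Suc n" "j < Suc n" "G $$ (i, j) \<noteq> 0"
      using G by (metis carrier_matD eq_matI index_zero_mat)
    define w where "w = col G j"
    have "w $ i = G $$ (i, j)" using G ij by (simp add: w_def)
    then have "w \<noteq> 0\<^sub>v (Suc n)" using ij by force
    moreover have "w \<in> carrier_vec (Suc n)" using G by (intro carrier_vecI) (simp add: w_def)
    ultimately have w: "w \<in> carrier_vec (Suc n)" "w \<noteq> 0\<^sub>v (Suc n)" by auto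
    have "E * G = G"
      using E unfolding G_def
      by (simp add: mult_add_distrib_mat[of _ "Suc n" "Suc n"] comm_add_mat[of "1\<^sub>m (Suc n)" "Suc n" "Suc n"])
    then have Ew: "E *\<^sub>v w = w" unfolding w_def using ij G E(1)
      by (metis carrier_matD(2) col_mult2)
    obtain P where "P \<in> nonsingular_mats (Suc n)" and P0: "col P 0 = w"
      using nonsingular_with_first_column[OF w] by blast
    then obtain Q where PQ: "P \<in> carrier_mat (Suc n) (Suc n)" "Q \<in> carrier_mat (Suc n) (Suc n)"
      "P * Q = 1\<^sub>m (Suc n)" "Q * P = 1\<^sub>m (Suc n)" by (elim nonsingularE)
    define B where "B = Q * E * P"
    have B: "B \<in> carrier_mat (Suc n) (Suc n)" using PQ E by (simp add: B_def mult_carrier_mat[of _ "Suc n" "Suc n"])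
    have sim: "similar_mat_wit E B P Q"
    proof (rule similar_mat_witI[OF PQ(3,4)])
      have "P * B * Q = (P * Q) * E * (P * Q)"
        using PQ(1,2) E(1) by (simp add: B_def assoc_mult_mat[of _ "Suc n" "Suc n" _ "Suc n" _ "Suc n"] mult_carrier_mat[of _ "Suc n" "Suc n"])
      then show "E = P * B * Q" using PQ E by simp
    qed (use PQ E B in auto)
    have BB: "B * B = 1\<^sub>m (Suc n)"
    proof -
      have "B * B = Q * E * (P * Q) * E * P"
        using PQ(1,2) E(1) by (simp add: B_def assoc_mult_mat[of _ "Suc n" "Suc n" _ "Suc n" _ "Suc n"] mult_carrier_mat[of _ "Suc n" "Suc n"])
      also have "\<dots> = Q * (E * E) * P"
        using PQ E(1) by (simp add: assoc_mult_mat[of _ "Suc n" "Suc n" _ "Suc n" _ "Suc n"] mult_carrier_mat[of _ "Suc n" "Suc n"])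
      finally show ?thesis using PQ E by simp
    qed
    have EP: "E * P \<in> carrier_mat (Suc n) (Suc n)" using E(1) PQ(1) by (rule mult_carrier_mat)
    have "B = Q * (E * P)" unfolding B_def by (rule assoc_mult_mat[OF PQ(2) E(1) PQ(1)])
    then have "col B 0 = Q *\<^sub>v (E *\<^sub>v col P 0)"
      using col_mult2[OF PQ(2) EP, of 0] col_mult2[OF E(1) PQ(1), of 0] by simp
    also have "\<dots> = Q *\<^sub>v col P 0" by (simp add: P0 Ew)
    also have "\<dots> = col (Q * P) 0" using col_mult2[OF PQ(2) PQ(1), of 0] by simp
    also have "\<dots> = unit_vec (Suc n) 0" unfolding PQ(4) by simp
    finally have col: "col B 0 = unit_vec (Suc n) 0" .
    obtain E' where E': "E' \<in> carrier_mat n n" "E' * E' = 1\<^sub>m n"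
      "similar_mat B (four_block_mat (1\<^sub>m 1) (0\<^sub>m 1 n) (0\<^sub>m n 1) E')"
      using involutory_mat_unit_block[OF two B BB col] by blast
    obtain p where p: "p \<le> n" "similar_mat E' (signature_mat p (n - p))" using Suc.IH[OF E'(1,2)] by blast
    have "similar_mat (four_block_mat (1\<^sub>m 1) (0\<^sub>m 1 n) (0\<^sub>m n 1) E')
        (four_block_mat (1\<^sub>m 1) (0\<^sub>m 1 n) (0\<^sub>m n 1) (signature_mat p (n - p)))"
      using p(2) E'(1) by (intro similar_mat_four_block_0_0 similar_mat_refl[of _ 1]) auto
    also have "four_block_mat (1\<^sub>m 1) (0\<^sub>m 1 n) (0\<^sub>m n 1) (signature_mat p (n - p)) =
        signature_mat (Suc p) (Suc n - Suc p)"
      using p(1) by (intro eq_matI) (auto simp: signature_mat_eq_diag mat_diag_def)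
    finally have "similar_mat E (signature_mat (Suc p) (Suc n - Suc p))"
      using E'(3) sim similar_mat_trans unfolding similar_mat_def by (metis similar_mat_def similar_mat_trans)
    then show ?thesis using p(1) by (intro exI[of _ "Suc p"]) simp
  qed
qed

text \<open>
  Versions of the library laws with a single dimension: as rewrite rules for square matrices they can
  discharge their own carrier conditions.
\<close>
lemma sq_mult_carrier: "A \<in> carrier_mat n n \<Longrightarrow> B \<in> carrier_mat n n \<Longrightarrow> A * B \<in> carrier_mat n n"
  by (rule mult_carrier_mat)

lemma sq_assoc:
  "A \<in> carrier_mat n n \<Longrightarrow> B \<in> carrier_mat n n \<Longrightarrow> C \<in> carrier_mat n n \<Longrightarrow> A * B * C = A * (B * C)"
  for A B C :: "'a :: semiring_0 mat"
  by (rule assoc_mult_mat)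

lemma sq_cancel:
  fixes P Q :: "'a :: semiring_1 mat"
  assumes "P \<in> carrier_mat n n" "Q \<in> carrier_mat n n" "P * Q = 1\<^sub>m n" "A \<in> carrier_mat n n"
  shows "P * (Q * A) = A"
  using sq_assoc[of P n Q A] assms by simp

lemma nonsingularI_right:
  fixes A :: "'a :: field mat"
  assumes "A \<in> carrier_mat n n" "B \<in> carrier_mat n n" "A * B = 1\<^sub>m n"
  shows "A \<in> nonsingular_mats n"
  using assms mat_mult_left_right_inverse[OF assms] by (intro nonsingularI)

lemma nonsingular_mult:
  assumes "S \<in> nonsingular_mats n" "T \<in> nonsingular_mats n"
  shows "S * T \<in> nonsingular_mats n"
proof -
  obtain S' where S: "S \<in> carrier_mat n n" "S' \<in> carrier_mat n n" "S * S' = 1\<^sub>m n" "S' * S = 1\<^sub>m n"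
    using assms(1) by (rule nonsingularE)
  obtain T' where T: "T \<in> carrier_mat n n" "T' \<in> carrier_mat n n" "T * T' = 1\<^sub>m n" "T' * T = 1\<^sub>m n"
    using assms(2) by (rule nonsingularE)
  show ?thesis
    by (rule nonsingularI[of _ _ "T' * S'"])
      (use S T in \<open>simp_all add: sq_mult_carrier sq_assoc[of _ n] sq_cancel[OF T(1-3)] sq_cancel[OF S(2,1,4)]\<close>)
qed

text \<open>
  Entry \<open>(i, j)\<close> of the commutator is \<open>(d\<^sub>i - d\<^sub>j) C\<^sub>i\<^sub>j\<close> for the diagonal entries \<open>d\<^sub>i = \<plusminus> 1\<close>, and
  \<open>\<plusminus> 2\<close> is invertible.
\<close>
lemma block_diag_iff_commutes_signature:
  fixes C :: "'a :: field mat"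
  assumes two: "(2 :: 'a) \<noteq> 0" and p: "p \<le> n" and C: "C \<in> carrier_mat n n"
  shows "C \<in> block_diag_mats p (n - p) \<longleftrightarrow>
    signature_mat p (n - p) * C = C * signature_mat p (n - p)" (is "_ \<longleftrightarrow> ?comm")
proof -
  define d :: "nat \<Rightarrow> 'a" where "d i = (if i < p then 1 else - 1)" for i
  have D: "signature_mat p (n - p) = mat_diag n d"
    using p by (simp add: signature_mat_eq_diag d_def[abs_def])
  have "?comm \<longleftrightarrow> (\<forall>i<n. \<forall>j<n. d i * C $$ (i, j) = C $$ (i, j) * d j)"
    unfolding D mat_diag_mult_left[OF C] mat_diag_mult_right[OF C] by (auto simp: mat_eq_iff)
  also have "\<dots> \<longleftrightarrow> (\<forall>i<n. \<forall>j<n. (i < p) \<noteq> (j < p) \<longrightarrow> C $$ (i, j) = 0)"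
  proof -
    have "- x = x \<longleftrightarrow> x = 0" "x = - x \<longleftrightarrow> x = 0" for x :: 'a
      using two by (metis add.inverse_neutral add_eq_0_iff mult_2 mult_eq_0_iff)+
    then show ?thesis using two two[symmetric] p by (auto simp: d_def)
  qed
  also have "\<dots> \<longleftrightarrow> C \<in> block_diag_mats p (n - p)"
  proof
    assume zero: "\<forall>i<n. \<forall>j<n. (i < p) \<noteq> (j < p) \<longrightarrow> C $$ (i, j) = 0"
    let ?B = "block_diag (mat p p (\<lambda>(i, j). C $$ (i, j)))
      (mat (n - p) (n - p) (\<lambda>(i, j). C $$ (i + p, j + p)))"
    have "?B \<in> block_diag_mats p (n - p)"
      unfolding block_diag_mats_def by (intro CollectI exI conjI) (rule refl, simp_all)
    moreover have "?B = C"
      unfolding block_diag_def using C p zero by (intro eq_matI) auto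
    ultimately show "C \<in> block_diag_mats p (n - p)"
      by (rule back_subst[where P = "\<lambda>x. x \<in> block_diag_mats p (n - p)"])
  next
    assume "C \<in> block_diag_mats p (n - p)"
    then show "\<forall>i<n. \<forall>j<n. (i < p) \<noteq> (j < p) \<longrightarrow> C $$ (i, j) = 0"
      using p unfolding block_diag_mats_def block_diag_def by auto
  qed
  finally show ?thesis by simp
qed

section \<open>Symmetric equivalence and congruence of tuples\<close>

context field_involution
begin

lemma star_carrier: "A \<in> carrier_mat n m \<Longrightarrow> star_mat \<sigma> A \<in> carrier_mat m n"
  by (simp add: star_mat_def)

lemma star_mult:
  assumes "A \<in> carrier_mat n m" "B \<in> carrier_mat m k"
  shows "star_mat \<sigma> (A * B) = star_mat \<sigma> B * star_mat \<sigma> A"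
  unfolding star_mat_def mat_hom_mult[OF assms]
  by (rule transpose_mult) (use assms in auto)

lemma star_one: "star_mat \<sigma> (1\<^sub>m n) = 1\<^sub>m n"
  by (simp add: star_mat_def mat_hom_one)

lemma star_signature: "star_mat \<sigma> (signature_mat p q) = signature_mat p q"
  by (rule eq_matI) (auto simp: star_mat_def signature_mat_eq_diag mat_diag_def hom_distribs)

lemma star_poly_mat:
  assumes "M \<in> carrier_mat n n" "f \<in> real_polys"
  shows "star_mat \<sigma> (poly_mat f M) = poly_mat f (star_mat \<sigma> M)"
proof -
  have "map_mat \<sigma> (poly_mat f M) = poly_mat f (map_mat \<sigma> M)"
    using poly_mat_map[OF comm_ring_hom_axioms assms(1), of f] assms(2) by (simp add: real_polys_def)
  then show ?thesis using assms(1) poly_mat_transpose[of "map_mat \<sigma> M" n f] by (simp add: star_mat_def)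
qed

text \<open>
  The star operation conjugates the coefficients of a polynomial in \<open>M\<close>; for a real polynomial the
  intertwining relation between \<open>M\<close> and its star is therefore inherited.
\<close>
lemma real_poly_intertwine:
  assumes "M \<in> carrier_mat n n" "A \<in> carrier_mat n n" "M * A = A * star_mat \<sigma> M" "f \<in> real_polys"
  shows "poly_mat f M * A = A * star_mat \<sigma> (poly_mat f M)"
  using poly_mat_intertwine[OF assms(1,2) star_carrier assms(3)] assms(1,4) star_poly_mat by metis

text \<open>
  For transformations \<open>S\<close> and \<open>R\<close> as in the definition, \<open>M = R\<inverse> S\<close> measures how far they are from
  a congruence, and the two defining equations say that \<open>M\<close> intertwines with its star.
\<close>
lemma star_symmetrically_equivalentE:
  assumes A: "\<A> \<in> mat_tuples n t" and eq: "star_symmetrically_equivalent \<sigma> n \<A> \<B>"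
  obtains R M where "R \<in> nonsingular_mats n" "M \<in> nonsingular_mats n"
    "\<And>Y. Y \<in> set \<A> \<Longrightarrow> M * Y = Y * star_mat \<sigma> M"
    "\<B> = map (\<lambda>Y. R * (M * Y) * star_mat \<sigma> R) \<A>"
proof -
  obtain S R where SR: "S \<in> nonsingular_mats n" "R \<in> nonsingular_mats n"
    "tuple_mult S \<A> (star_mat \<sigma> R) = \<B>" "tuple_mult R \<A> (star_mat \<sigma> S) = \<B>"
    using eq unfolding star_symmetrically_equivalent_def by blast
  obtain S' where S: "S \<in> carrier_mat n n" "S' \<in> carrier_mat n n" "S * S' = 1\<^sub>m n" "S' * S = 1\<^sub>m n"
    using SR(1) by (rule nonsingularE)
  obtain R' where R: "R \<in> carrier_mat n n" "R' \<in> carrier_mat n n" "R * R' = 1\<^sub>m n" "R' * R = 1\<^sub>m n"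
    using SR(2) by (rule nonsingularE)
  have "R' \<in> nonsingular_mats n" by (rule nonsingularI[of _ _ R]) (use R in auto)
  then have M: "R' * S \<in> nonsingular_mats n" using SR(1) by (rule nonsingular_mult)
  have Yc: "Y \<in> carrier_mat n n" if "Y \<in> set \<A>" for Y using A that by (auto simp: mat_tuples_def)
  note assoc = sq_mult_carrier sq_assoc[of _ n] star_carrier
  show ?thesis
  proof (rule that[OF SR(2) M])
    fix Y assume Y: "Y \<in> set \<A>"
    have eq: "S * Y * star_mat \<sigma> R = R * Y * star_mat \<sigma> S"
      using trans[OF SR(3) SR(4)[symmetric]] Y unfolding tuple_mult_def map_eq_conv by blast
    have "star_mat \<sigma> R * star_mat \<sigma> R' = 1\<^sub>m n"
      using R by (simp add: star_one flip: star_mult)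
    then have "R' * S * Y = R' * (S * Y * star_mat \<sigma> R) * star_mat \<sigma> R'"
      using S(1) R(1,2) Yc[OF Y] by (simp add: assoc)
    also have "\<dots> = (R' * R) * Y * (star_mat \<sigma> S * star_mat \<sigma> R')"
      unfolding eq using S(1) R(1,2) Yc[OF Y] by (simp add: assoc)
    also have "\<dots> = Y * star_mat \<sigma> (R' * S)"
      using Yc[OF Y] by (simp add: R(4) star_mult[OF R(2) S(1)])
    finally show "R' * S * Y = Y * star_mat \<sigma> (R' * S)" .
  next
    have "S * Y * star_mat \<sigma> R = R * (R' * S * Y) * star_mat \<sigma> R" if "Y \<in> set \<A>" for Y
      using S(1) R(1,2) Yc[OF that] by (simp add: assoc sq_cancel[OF R(1-3)])
    then show "\<B> = map (\<lambda>Y. R * (R' * S * Y) * star_mat \<sigma> R) \<A>"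
      unfolding SR(3)[symmetric] tuple_mult_def by simp
  qed
qed

lemma star_congruent_imp_symmetrically_equivalent:
  "star_congruent \<sigma> n \<A> \<B> \<Longrightarrow> star_symmetrically_equivalent \<sigma> n \<A> \<B>"
  unfolding star_congruent_def star_symmetrically_equivalent_def by blast

text \<open>
  If \<open>M = N\<^sup>2\<close> with \<open>N\<close> a real polynomial in \<open>M\<close>, then \<open>M A = N A N\<^sup>*\<close>, so \<open>R N\<close> is a congruence.
\<close>
lemma sqrt_imp_star_congruent:
  assumes A: "\<A> \<in> mat_tuples n t" and eq: "star_symmetrically_equivalent \<sigma> n \<A> \<B>"
    and sqrt: "\<And>M. M \<in> nonsingular_mats n \<Longrightarrow> \<exists>f\<in>real_polys. poly_mat f M * poly_mat f M = M"
  shows "star_congruent \<sigma> n \<A> \<B>"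
proof -
  obtain R M where R: "R \<in> nonsingular_mats n" and M: "M \<in> nonsingular_mats n"
    and MY: "\<And>Y. Y \<in> set \<A> \<Longrightarrow> M * Y = Y * star_mat \<sigma> M"
    and B: "\<B> = map (\<lambda>Y. R * (M * Y) * star_mat \<sigma> R) \<A>"
    using star_symmetrically_equivalentE[OF A eq] by blast
  obtain f where f: "f \<in> real_polys" "poly_mat f M * poly_mat f M = M" using sqrt[OF M] by blast
  define N where "N = poly_mat f M"
  obtain M' where M': "M \<in> carrier_mat n n" "M' \<in> carrier_mat n n" "M * M' = 1\<^sub>m n" "M' * M = 1\<^sub>m n"
    using M by (rule nonsingularE)
  have Nc: "N \<in> carrier_mat n n" unfolding N_def by (rule poly_mat_carrier[OF M'(1)])
  have NN: "N * N = M" using f by (simp add: N_def)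
  have Rc: "R \<in> carrier_mat n n" using R by (rule nonsingularE)
  have "N * (N * M') = 1\<^sub>m n" using M' Nc by (simp add: NN flip: sq_assoc)
  then have "N \<in> nonsingular_mats n"
    using Nc M' by (intro nonsingularI_right[of N n "N * M'"]) (simp_all add: sq_mult_carrier)
  then have "R * N \<in> nonsingular_mats n" using R by (rule nonsingular_mult[rotated])
  moreover have "R * (M * Y) * star_mat \<sigma> R = R * N * Y * star_mat \<sigma> (R * N)" if "Y \<in> set \<A>" for Y
  proof -
    have Y: "Y \<in> carrier_mat n n" using A that by (auto simp: mat_tuples_def)
    have "N * Y = Y * star_mat \<sigma> N"
      unfolding N_def by (rule real_poly_intertwine[OF M'(1) Y MY[OF that] f(1)])
    then have "M * Y = N * (Y * star_mat \<sigma> N)"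
      unfolding NN[symmetric] using Y Nc by (simp add: sq_assoc[of _ n])
    then show ?thesis using Y Rc Nc
      by (simp add: sq_mult_carrier sq_assoc[of _ n] star_carrier star_mult[of _ n n _ n])
  qed
  ultimately show ?thesis
    unfolding B star_congruent_def tuple_mult_def by (intro bexI[of _ "R * N"]) simp_all
qed

text \<open>
  If \<open>M = N E N\<close> with \<open>E\<^sup>2 = 1\<close>, then \<open>M A = N (E A) N\<^sup>*\<close>. In a basis diagonalising \<open>E = Q D P\<close>, where
  \<open>Q = P\<inverse>\<close>, the matrix \<open>A\<close> becomes \<open>C = P A P\<^sup>*\<close>, and \<open>E A = A E\<^sup>*\<close> becomes \<open>D C = C D\<close>: the
  matrix \<open>C\<close> is block diagonal and \<open>D C\<close> is congruent to \<open>E A\<close>.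
\<close>
lemma signed_sqrt_imp_signature_congruent:
  assumes two: "(2 :: 'a) \<noteq> 0"
    and A: "\<A> \<in> mat_tuples n t" and eq: "star_symmetrically_equivalent \<sigma> n \<A> \<B>"
    and sqrt: "\<And>M. M \<in> nonsingular_mats n \<Longrightarrow> \<exists>e\<in>real_polys. \<exists>f\<in>real_polys.
      poly_mat e M * poly_mat e M = 1\<^sub>m n \<and> poly_mat f M * poly_mat e M * poly_mat f M = M"
  shows "\<exists>p\<in>{0..n}. \<exists>\<C>\<in>mat_tuples n t. set \<C> \<subseteq> block_diag_mats p (n - p) \<and>
    star_congruent \<sigma> n \<A> \<C> \<and>
    star_congruent \<sigma> n (tuple_left_mult (signature_mat p (n - p)) \<C>) \<B>"
proof -
  obtain R M where R: "R \<in> nonsingular_mats n" and M: "M \<in> nonsingular_mats n"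
    and MY: "\<And>Y. Y \<in> set \<A> \<Longrightarrow> M * Y = Y * star_mat \<sigma> M"
    and B: "\<B> = map (\<lambda>Y. R * (M * Y) * star_mat \<sigma> R) \<A>"
    using star_symmetrically_equivalentE[OF A eq] by blast
  obtain e f where ef: "e \<in> real_polys" "f \<in> real_polys" "poly_mat e M * poly_mat e M = 1\<^sub>m n"
    "poly_mat f M * poly_mat e M * poly_mat f M = M" using sqrt[OF M] by blast
  obtain M' where M': "M \<in> carrier_mat n n" "M' \<in> carrier_mat n n" "M * M' = 1\<^sub>m n" "M' * M = 1\<^sub>m n"
    using M by (rule nonsingularE)
  define E N where "E = poly_mat e M" and "N = poly_mat f M"
  have c: "E \<in> carrier_mat n n" "N \<in> carrier_mat n n" "R \<in> carrier_mat n n"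
    unfolding E_def N_def using poly_mat_carrier[OF M'(1)] R by (auto elim: nonsingularE)
  have NEN: "N * (E * N) = M" using ef(4) c by (simp add: E_def N_def sq_assoc[of _ n])
  obtain p where p: "p \<le> n" "similar_mat E (signature_mat p (n - p))"
    using involutory_mat_similar_signature[OF two c(1)] ef(3) unfolding E_def by blast
  define D where "D = (signature_mat p (n - p) :: 'a mat)"
  obtain Q P where QP: "P \<in> carrier_mat n n" "Q \<in> carrier_mat n n" "Q * P = 1\<^sub>m n" "P * Q = 1\<^sub>m n"
    and EQP: "E = Q * D * P" and Dc: "D \<in> carrier_mat n n"
    using p(2) similar_mat_witD2[OF c(1)] unfolding similar_mat_def D_def by metis
  have Pn: "P \<in> nonsingular_mats n" and Qn: "Q \<in> nonsingular_mats n"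
    using QP by (auto intro: nonsingularI)
  have starQP: "star_mat \<sigma> P * star_mat \<sigma> Q = 1\<^sub>m n"
    using QP by (simp add: star_one flip: star_mult)
  note assoc = sq_mult_carrier sq_assoc[of _ n] star_carrier
  have Ds: "star_mat \<sigma> D = D" unfolding D_def by (rule star_signature)
  have PE: "P * E = D * P" using QP(1,2) Dc by (simp add: EQP assoc sq_cancel[OF QP(1,2,4)])
  have starPE: "star_mat \<sigma> P * D = star_mat \<sigma> E * star_mat \<sigma> P"
    using arg_cong[OF PE, of "star_mat \<sigma>"] QP c Dc by (simp add: star_mult[of _ n n _ n] Ds)
  have Yc: "Y \<in> carrier_mat n n" if "Y \<in> set \<A>" for Y using A that by (auto simp: mat_tuples_def)
  have EY: "E * Y = Y * star_mat \<sigma> E" and NY: "N * Y = Y * star_mat \<sigma> N" if "Y \<in> set \<A>" for Y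
    unfolding E_def N_def
    by (rule real_poly_intertwine[OF M'(1) Yc[OF that] MY[OF that]]; fact ef)+
  define \<C> where "\<C> = map (\<lambda>Y. P * Y * star_mat \<sigma> P) \<A>"
  show ?thesis
  proof (intro bexI conjI)
    show "p \<in> {0..n}" using p by simp
    show "\<C> \<in> mat_tuples n t"
      using A QP by (auto simp: \<C>_def mat_tuples_def intro!: sq_mult_carrier star_carrier)
    show "star_congruent \<sigma> n \<A> \<C>"
      unfolding star_congruent_def \<C>_def tuple_mult_def using Pn by blast
    show "set \<C> \<subseteq> block_diag_mats p (n - p)"
    proof
      fix C assume "C \<in> set \<C>"
      then obtain Y where Y: "Y \<in> set \<A>" "C = P * Y * star_mat \<sigma> P" by (auto simp: \<C>_def)
      have "D * C = P * (E * Y) * star_mat \<sigma> P"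
      proof -
        have "D * C = (D * P) * (Y * star_mat \<sigma> P)"
          unfolding Y(2) using Yc[OF Y(1)] QP(1) Dc by (simp add: assoc)
        also have "\<dots> = P * (E * Y) * star_mat \<sigma> P"
          unfolding PE[symmetric] using Yc[OF Y(1)] QP(1) c(1) by (simp add: assoc)
        finally show ?thesis .
      qed
      also have "\<dots> = C * D"
        unfolding EY[OF Y(1)] Y(2) using Yc[OF Y(1)] QP(1) c(1) Dc by (simp add: assoc starPE)
      finally show "C \<in> block_diag_mats p (n - p)"
        using block_diag_iff_commutes_signature[OF two p(1), of C] Y(2) Yc[OF Y(1)] QP
        unfolding D_def by (simp add: sq_mult_carrier star_carrier)
    qed
    have "N * (E * (N * M')) = 1\<^sub>m n" 
      using sq_assoc[of N n "E * N" M'] M'(1-3) c by (simp add: assoc NEN)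
    then have "N \<in> nonsingular_mats n"
      using c M' by (intro nonsingularI_right[of N n "E * (N * M')"]) (simp_all add: sq_mult_carrier)
    then have RNQ: "R * N * Q \<in> nonsingular_mats n" using R Qn nonsingular_mult by blast
    have "R * (M * Y) * star_mat \<sigma> R = R * N * Q * (D * (P * Y * star_mat \<sigma> P)) * star_mat \<sigma> (R * N * Q)"
      if "Y \<in> set \<A>" for Y
    proof -
      note Y = Yc[OF that]
      have "M * Y = N * (E * (Y * star_mat \<sigma> N))"
        unfolding NEN[symmetric] using Y c(1,2) by (simp add: assoc NY[OF that])
      moreover have "Q * (D * (P * W)) = E * W" if "W \<in> carrier_mat n n" for W
        unfolding EQP using QP(1,2) Dc that by (simp add: assoc)
      moreover have "star_mat \<sigma> P * (star_mat \<sigma> Q * W) = W" if "W \<in> carrier_mat n n" for W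
        by (rule sq_cancel[OF _ _ starQP that]) (use QP in \<open>simp_all add: star_carrier\<close>)
      moreover have "star_mat \<sigma> (R * N * Q) = star_mat \<sigma> Q * (star_mat \<sigma> N * star_mat \<sigma> R)"
        using c QP(2) by (simp add: star_mult[of _ n n _ n] assoc)
      ultimately show ?thesis
        using Y c QP(1,2) Dc by (simp add: assoc)
    qed
    then have "tuple_mult (R * N * Q) (tuple_left_mult D \<C>) (star_mat \<sigma> (R * N * Q)) = \<B>"
      by (simp add: tuple_mult_def tuple_left_mult_def \<C>_def B)
    then show "star_congruent \<sigma> n (tuple_left_mult (signature_mat p (n - p)) \<C>) \<B>"
      unfolding star_congruent_def D_def using RNQ by blast
  qed
qed

text \<open>
  Block diagonal matrices commute with \<open>D\<close>, so \<open>D C = D C 1\<^sup>* = 1 C D\<^sup>*\<close> is a symmetric equivalence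
  between \<open>C\<close> and \<open>D C\<close>; it is composed with the two congruences.
\<close>
lemma signature_congruent_imp_symmetrically_equivalent:
  assumes two: "(2 :: 'a) \<noteq> 0" and p: "p \<le> n"
    and A: "\<A> \<in> mat_tuples n t" and block: "set \<C> \<subseteq> block_diag_mats p (n - p)"
    and AC: "star_congruent \<sigma> n \<A> \<C>"
    and CB: "star_congruent \<sigma> n (tuple_left_mult (signature_mat p (n - p)) \<C>) \<B>"
  shows "star_symmetrically_equivalent \<sigma> n \<A> \<B>"
proof -
  define D where "D = (signature_mat p (n - p) :: 'a mat)"
  have Dc: "D \<in> carrier_mat n n" unfolding D_def by (rule signature_mat_carrier[OF p])
  have Ds: "star_mat \<sigma> D = D" unfolding D_def by (rule star_signature)
  have "D * D = 1\<^sub>m n"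
    using p by (simp add: D_def signature_mat_eq_diag if_distrib cong: if_cong)
  then have Dn: "D \<in> nonsingular_mats n" using Dc by (intro nonsingularI)
  obtain S where S: "S \<in> nonsingular_mats n" "tuple_mult S \<A> (star_mat \<sigma> S) = \<C>"
    using AC unfolding star_congruent_def by blast
  obtain T where T: "T \<in> nonsingular_mats n"
    "tuple_mult T (tuple_left_mult D \<C>) (star_mat \<sigma> T) = \<B>"
    using CB unfolding star_congruent_def D_def by blast
  have c: "S \<in> carrier_mat n n" "T \<in> carrier_mat n n" using S(1) T(1) by (auto elim: nonsingularE)
  note simps = sq_mult_carrier sq_assoc[of _ n] star_carrier star_mult[of _ n n _ n] Ds
  have B: "\<B> = map (\<lambda>Y. T * (D * (S * Y * star_mat \<sigma> S)) * star_mat \<sigma> T) \<A>"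
    unfolding T(2)[symmetric] S(2)[symmetric] by (simp add: tuple_mult_def tuple_left_mult_def)
  have Yc: "Y \<in> carrier_mat n n" if "Y \<in> set \<A>" for Y using A that by (auto simp: mat_tuples_def)
  have comm: "D * (S * Y * star_mat \<sigma> S) = S * Y * star_mat \<sigma> S * D" if "Y \<in> set \<A>" for Y
  proof -
    have "S * Y * star_mat \<sigma> S \<in> block_diag_mats p (n - p)"
      using block that unfolding S(2)[symmetric] tuple_mult_def by auto
    then show ?thesis
      using block_diag_iff_commutes_signature[OF two p, of "S * Y * star_mat \<sigma> S"] Yc[OF that] c
      unfolding D_def by (simp add: sq_mult_carrier star_carrier)
  qed
  have 1: "T * D * S * Y * star_mat \<sigma> (T * S) = T * (D * (S * Y * star_mat \<sigma> S)) * star_mat \<sigma> T"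
    if "Y \<in> set \<A>" for Y
    using Yc[OF that] c Dc by (simp add: simps)
  have 2: "T * S * Y * star_mat \<sigma> (T * D * S) = T * (D * (S * Y * star_mat \<sigma> S)) * star_mat \<sigma> T"
    if "Y \<in> set \<A>" for Y
    unfolding comm[OF that] using Yc[OF that] c Dc by (simp add: simps)
  have "tuple_mult (T * D * S) \<A> (star_mat \<sigma> (T * S)) = \<B>"
    "tuple_mult (T * S) \<A> (star_mat \<sigma> (T * D * S)) = \<B>"
    using 1 2 unfolding B tuple_mult_def by simp_all
  moreover have "T * D * S \<in> nonsingular_mats n" "T * S \<in> nonsingular_mats n"
    using S(1) T(1) Dn nonsingular_mult by blast+
  ultimately show ?thesis unfolding star_symmetrically_equivalent_def by blast
qed

lemma weakly_star_symmetrically_equivalent_iff: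
  assumes two: "(2 :: 'a) \<noteq> 0" and A: "\<A> \<in> mat_tuples n t"
    and sqrt: "\<And>M. M \<in> nonsingular_mats n \<Longrightarrow> \<exists>e\<in>real_polys. \<exists>f\<in>real_polys.
      poly_mat e M * poly_mat e M = 1\<^sub>m n \<and> poly_mat f M * poly_mat e M * poly_mat f M = M"
  shows "weakly (star_symmetrically_equivalent \<sigma>) n \<A> \<B> \<longleftrightarrow>
    (\<exists>p\<in>{0..n}. \<exists>\<C>\<in>mat_tuples n t. set \<C> \<subseteq> block_diag_mats p (n - p) \<and>
      star_congruent \<sigma> n \<A> \<C> \<and>
      weakly (star_congruent \<sigma>) n (tuple_left_mult (signature_mat p (n - p)) \<C>) \<B>)"
    (is "?L \<longleftrightarrow> ?R")
proof
  assume ?L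
  then obtain \<Lambda> where \<Lambda>: "\<Lambda> \<in> nonsingular_mats (length \<B>)"
    "star_symmetrically_equivalent \<sigma> n \<A> (lin_comb_tuple n \<Lambda> \<B>)"
    unfolding weakly_def by blast
  show ?R
    using signed_sqrt_imp_signature_congruent[OF two A \<Lambda>(2) sqrt] \<Lambda>(1) unfolding weakly_def by blast
next
  assume ?R
  then obtain p \<C> \<Lambda> where *: "p \<le> n" "set \<C> \<subseteq> block_diag_mats p (n - p)" "star_congruent \<sigma> n \<A> \<C>"
    "\<Lambda> \<in> nonsingular_mats (length \<B>)"
    "star_congruent \<sigma> n (tuple_left_mult (signature_mat p (n - p)) \<C>) (lin_comb_tuple n \<Lambda> \<B>)"
    unfolding weakly_def by auto
  show ?L
    using signature_congruent_imp_symmetrically_equivalent[OF two *(1) A *(2,3,5)] *(4)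
    unfolding weakly_def by blast
qed

end

lemma real_polys_id: "field_involution.real_polys id = UNIV"
  using field_involution.real_polys_def[OF id_field_involution] by (auto simp: map_poly_id)

lemma star_mat_id: "star_mat id A = transpose_mat A"
  by (rule eq_matI) (auto simp: star_mat_def)

lemma star_id:
  "star_symmetrically_equivalent id = symmetrically_equivalent" "star_congruent id = tuple_congruent"
  by (intro ext; simp add: star_symmetrically_equivalent_def symmetrically_equivalent_def
      star_congruent_def tuple_congruent_def star_mat_id)+

theorem corollary1:
  fixes n t :: nat
  shows
    "(CHAR('a :: alg_closed_field) \<noteq> 2 \<longrightarrow>
        (\<forall>\<A> \<in> mat_tuples n t. \<forall>\<B> \<in> mat_tuples n t.
           weakly symmetrically_equivalent n \<A> (\<B> :: 'a mat list) \<longleftrightarrow>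
           weakly tuple_congruent n \<A> \<B>))
     \<and>
     (real_closed_field TYPE('b :: field) \<longrightarrow>
        (\<forall>\<A> \<in> mat_tuples n t. \<forall>\<B> \<in> mat_tuples n t.
           weakly symmetrically_equivalent n \<A> (\<B> :: 'b mat list) \<longleftrightarrow>
           (\<exists>p \<in> {0..n}. \<exists>\<C> \<in> mat_tuples n t.
              set \<C> \<subseteq> block_diag_mats p (n - p) \<and>
              tuple_congruent n \<A> \<C> \<and>
              weakly tuple_congruent n (tuple_left_mult (signature_mat p (n - p)) \<C>) \<B>)))
     \<and>
     (\<forall>\<sigma> :: 'c :: alg_closed_field \<Rightarrow> 'c. involution \<sigma> \<and> \<sigma> \<noteq> id \<longrightarrow>
        (\<forall>\<A> \<in> mat_tuples n t. \<forall>\<B> \<in> mat_tuples n t.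
           weakly (star_symmetrically_equivalent \<sigma>) n \<A> \<B> \<longleftrightarrow>
           (\<exists>p \<in> {0..n}. \<exists>\<C> \<in> mat_tuples n t.
              set \<C> \<subseteq> block_diag_mats p (n - p) \<and>
              star_congruent \<sigma> n \<A> \<C> \<and>
              weakly (star_congruent \<sigma>) n (tuple_left_mult (signature_mat p (n - p)) \<C>) \<B>)))"
proof (intro conjI impI allI ballI)
  fix \<A> \<B> :: "'a mat list"
  assume char: "CHAR('a) \<noteq> 2" and A: "\<A> \<in> mat_tuples n t"
  interpret field_involution "id :: 'a \<Rightarrow> 'a" by (rule id_field_involution)
  have two: "(2 :: 'a) \<noteq> 0"
  proof
    assume "(2 :: 'a) = 0"
    then have "CHAR('a) dvd 2" using of_nat_eq_0_iff_char_dvd[of 2, where ?'a = 'a] by simp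
    then have "CHAR('a) \<le> 2" by (rule dvd_imp_le) simp
    moreover have "CHAR('a) \<noteq> 0" using \<open>CHAR('a) dvd 2\<close> by (metis dvd_0_left_iff zero_neq_numeral)
    ultimately show False using char CHAR_not_1[where ?'a = 'a] by simp
  qed
  have "star_symmetrically_equivalent id n \<A> \<B>' \<longleftrightarrow> star_congruent id n \<A> \<B>'" for \<B>'
    using sqrt_imp_star_congruent[OF A] alg_closed_matrix_sqrt[OF two] real_polys_id
      star_congruent_imp_symmetrically_equivalent by (metis UNIV_I)
  then show "weakly symmetrically_equivalent n \<A> \<B> \<longleftrightarrow> weakly tuple_congruent n \<A> \<B>"
    unfolding weakly_def star_id by simp
next
  fix \<A> \<B> :: "'b mat list"
  assume F: "real_closed_field TYPE('b)" and A: "\<A> \<in> mat_tuples n t"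
  interpret field_involution "id :: 'b \<Rightarrow> 'b" by (rule id_field_involution)
  show "weakly symmetrically_equivalent n \<A> \<B> \<longleftrightarrow>
    (\<exists>p \<in> {0..n}. \<exists>\<C> \<in> mat_tuples n t. set \<C> \<subseteq> block_diag_mats p (n - p) \<and>
      tuple_congruent n \<A> \<C> \<and>
      weakly tuple_congruent n (tuple_left_mult (signature_mat p (n - p)) \<C>) \<B>)"
    unfolding star_id[symmetric]
    by (rule weakly_star_symmetrically_equivalent_iff[OF real_closed_two_neq_0[OF F] A])
      (use real_closed_signed_matrix_sqrt[OF F] in \<open>simp only: real_polys_id bex_UNIV ex_simps; blast\<close>)
next
  fix \<sigma> :: "'c \<Rightarrow> 'c" and \<A> \<B> :: "'c mat list"
  assume \<sigma>: "involution \<sigma> \<and> \<sigma> \<noteq> id" and A: "\<A> \<in> mat_tuples n t"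
  interpret alg_closed_involution \<sigma> by unfold_locales (use \<sigma> in auto)
  show "weakly (star_symmetrically_equivalent \<sigma>) n \<A> \<B> \<longleftrightarrow>
    (\<exists>p \<in> {0..n}. \<exists>\<C> \<in> mat_tuples n t. set \<C> \<subseteq> block_diag_mats p (n - p) \<and>
      star_congruent \<sigma> n \<A> \<C> \<and>
      weakly (star_congruent \<sigma>) n (tuple_left_mult (signature_mat p (n - p)) \<C>) \<B>)"
    by (rule weakly_star_symmetrically_equivalent_iff[OF two_neq_0 A signed_real_matrix_sqrt])
qed

end
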